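(* For every graph $G$ and every integer $i\geq 1$, $$\mathrm{mw}_i(G)=\min_{\mathcal{D}^1,\ldots,\mathcal{D}^i\in\mathcal{T}^G}\ \max\Big\{\Big|\bigcap_{j=1}^i Z^j_{t_j}\Big| : t_j\in V(T^j)\text{ for } j=1,\ldots,i\Big\},$$ where $\mathcal{T}^G$ is the set of tree decompositions of $G$ and $\mathcal{D}^j=(T^j,(Z^j_t)_{t\in V(T^j)})$.
   Context: All graphs are finite, simple and undirected. A tree decomposition of $G$ is a pair $(T,(Z_t)_{t\in V(T)})$ with $T$ a tree and $Z_t\subseteq V(G)$ such that every edge of $G$ has both ends in some $Z_t$, and for every $v\in V(G)$ the set $\{t: v\in Z_t\}$ is non-empty and induces a connected subtree of $T$. For vertices $u,v$ of a connected graph, $I(u,v)$ is the set of vertices on shortest $(u,v)$-paths; a vertex set $S$ is convex if $I(u,v)\subseteq S$ for all $u,v\in S$. A median graph is a connected graph $M$ with $|I(u,v)\cap I(v,w)\cap I(w,u)|=1$ for all vertices $u,v,w$. The tree dimension of a graph is the minimum $k$ such that it admits a distance-preserving embedding into a Cartesian product of $k$ trees. A median decomposition of $G$ is a pair $(M,\mathcal{X})$ with $M$ a median graph and $\mathcal{X}=(X_a)_{a\in V(M)}$ subsets of $V(G)$ such that (M1) every edge of $G$ has both ends in some $X_a$, and (M2) for every $v\in V(G)$, $\{a: v\in X_a\}$ is non-empty and convex in $M$; its width is $\max_a|X_a|$. An $i$-median decomposition is one whose median graph has tree dimension at most $i$; $\mathrm{mw}_i(G)$ is the minimum width of an $i$-median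 decomposition of $G$. *)

theory Defs
  imports "Graph_Theory.Graph_Theory" "HOL-Library.Extended_Nat" "HOL-Library.FuncSet"
begin

text \<open>
  A finite simple undirected graph is a \<open>pair_graph\<close> of the Graph Theory library: a finite
  loop-free digraph without parallel arcs whose arc relation is symmetric, so that an edge
  between \<open>u\<close> and \<open>v\<close> is the pair of arcs \<open>(u, v)\<close>, \<open>(v, u)\<close>.  The vertex set may be empty, but
  the library's connectedness requires a vertex, so trees and median graphs are nonempty.
\<close>

text \<open>
  The predicate \<open>tree\<close> of the library is unsuitable here: it also forbids the directed cycles
  \<open>[(u, v), (v, u)]\<close> of length 2, which exist in every symmetric digraph with an arc.  The cycles
  of an undirected graph are the library's cycles of length at least 3.
\<close>

definition undirected_tree :: "'a pair_pre_digraph \<Rightarrow> bool" where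
  "undirected_tree T \<longleftrightarrow> pair_graph T \<and> Digraph_Component.connected T \<and>
     \<not> (\<exists>p. pre_digraph.cycle T p \<and> 3 \<le> length p)"

text \<open>With unit weights, the library's minimum walk cost \<open>\<mu>\<close> is the graph distance.\<close>

definition gdist :: "'a pair_pre_digraph \<Rightarrow> 'a \<Rightarrow> 'a \<Rightarrow> ereal" where
  "gdist G u v = wf_digraph.\<mu> G (\<lambda>_. 1) u v"

definition shortest_path :: "'a pair_pre_digraph \<Rightarrow> 'a \<Rightarrow> ('a \<times> 'a) awalk \<Rightarrow> 'a \<Rightarrow> bool" where
  "shortest_path G u p v \<longleftrightarrow> pre_digraph.apath G u p v \<and> ereal (real (length p)) = gdist G u v"

definition interval :: "'a pair_pre_digraph \<Rightarrow> 'a \<Rightarrow> 'a \<Rightarrow> 'a set" where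
  "interval G u v = (\<Union>p \<in> {p. shortest_path G u p v}. set (pre_digraph.awalk_verts G u p))"

definition geodesically_convex :: "'a pair_pre_digraph \<Rightarrow> 'a set \<Rightarrow> bool" where
  "geodesically_convex G S \<longleftrightarrow> S \<subseteq> pverts G \<and> (\<forall>u\<in>S. \<forall>v\<in>S. interval G u v \<subseteq> S)"

definition median_graph :: "'a pair_pre_digraph \<Rightarrow> bool" where
  "median_graph M \<longleftrightarrow> pair_graph M \<and> Digraph_Component.connected M \<and>
     (\<forall>u\<in>pverts M. \<forall>v\<in>pverts M. \<forall>w\<in>pverts M.
        card (interval M u v \<inter> interval M v w \<inter> interval M w u) = 1)"

text \<open>The Cartesian product of the graphs \<open>H 0, \<dots>, H (k - 1)\<close>, with \<open>k\<close>-tuples as extensional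
  functions on \<open>{..<k}\<close>; for \<open>k = 0\<close> it is the one-vertex graph.\<close>

definition cartesian_product ::
  "nat \<Rightarrow> (nat \<Rightarrow> 'a pair_pre_digraph) \<Rightarrow> (nat \<Rightarrow> 'a) pair_pre_digraph" where
  "cartesian_product k H =
     \<lparr> pverts = (\<Pi>\<^sub>E j\<in>{..<k}. pverts (H j)),
       parcs = {(x, y). x \<in> (\<Pi>\<^sub>E j\<in>{..<k}. pverts (H j)) \<and> y \<in> (\<Pi>\<^sub>E j\<in>{..<k}. pverts (H j)) \<and>
                  (\<exists>j<k. (x j, y j) \<in> parcs (H j) \<and> (\<forall>l<k. l \<noteq> j \<longrightarrow> x l = y l))} \<rparr>"

definition isometric_embedding ::
  "'a pair_pre_digraph \<Rightarrow> 'b pair_pre_digraph \<Rightarrow> ('a \<Rightarrow> 'b) \<Rightarrow> bool" where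
  "isometric_embedding G H f \<longleftrightarrow> f \<in> pverts G \<rightarrow> pverts H \<and>
     (\<forall>u\<in>pverts G. \<forall>v\<in>pverts G. gdist H (f u) (f v) = gdist G u v)"

text \<open>
  Existentially quantified graphs (trees and median graphs) have vertices of type \<^typ>\<open>nat\<close>, which is
  no restriction because every finite graph is isomorphic to one of these.
  The tree dimension is \<open>\<infinity>\<close> for graphs without any embedding into a product of trees.
\<close>

definition tree_dimension :: "'a pair_pre_digraph \<Rightarrow> enat" where
  "tree_dimension G = Inf {enat k | k.
     \<exists>(T :: nat \<Rightarrow> nat pair_pre_digraph) f.
       (\<forall>j<k. undirected_tree (T j)) \<and> isometric_embedding G (cartesian_product k T) f}"

definition tree_decompositions ::
  "'a pair_pre_digraph \<Rightarrow> (nat pair_pre_digraph \<times> (nat \<Rightarrow> 'a set)) set" where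
  "tree_decompositions G = {(T, Z).
     undirected_tree T \<and>
     (\<forall>t\<in>pverts T. Z t \<subseteq> pverts G) \<and>
     (\<forall>(u, v)\<in>parcs G. \<exists>t\<in>pverts T. u \<in> Z t \<and> v \<in> Z t) \<and>
     (\<forall>v\<in>pverts G. {t \<in> pverts T. v \<in> Z t} \<noteq> {} \<and>
        Digraph_Component.connected (with_proj T \<restriction> {t \<in> pverts T. v \<in> Z t}))}"

definition median_decompositions ::
  "'a pair_pre_digraph \<Rightarrow> (nat pair_pre_digraph \<times> (nat \<Rightarrow> 'a set)) set" where
  "median_decompositions G = {(M, X).
     median_graph M \<and>
     (\<forall>a\<in>pverts M. X a \<subseteq> pverts G) \<and>
     (\<forall>(u, v)\<in>parcs G. \<exists>a\<in>pverts M. u \<in> X a \<and> v \<in> X a) \<and>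
     (\<forall>v\<in>pverts G. {a \<in> pverts M. v \<in> X a} \<noteq> {} \<and>
        geodesically_convex M {a \<in> pverts M. v \<in> X a})}"

definition width :: "'b pair_pre_digraph \<times> ('b \<Rightarrow> 'a set) \<Rightarrow> nat" where
  "width D = Max {card (snd D a) | a. a \<in> pverts (fst D)}"

text \<open>The one-vertex median graph with bag \<open>pverts G\<close> gives a median decomposition of tree dimension
  \<open>0\<close> of every graph \<open>G\<close>, so the minimum below is over a nonempty set.\<close>

definition mw :: "nat \<Rightarrow> 'a pair_pre_digraph \<Rightarrow> nat" where
  "mw i G = (LEAST w. \<exists>D\<in>median_decompositions G. tree_dimension (fst D) \<le> enat i \<and> width D = w)"

end

theory Submission
  imports Defs
begin

text \<open>
  Given \<open>i\<close> tree decompositions, take the Cartesian product of their trees, which is a median graph,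
  and assign to a tuple of nodes the intersection of their bags; the trace of a vertex is a product of
  subtrees, hence convex.  Conversely, embed the median graph of a decomposition isometrically into a
  product of \<open>i\<close> trees and let \<open>Z\<^sup>j\<^sub>t\<close> be the union of the bags at the nodes with \<open>j\<close>-th coordinate \<open>t\<close>.
  If \<open>u\<close> and \<open>v\<close> lie in \<open>Z\<^sup>1\<^sub>t\<^sub>1 \<inter> \<dots> \<inter> Z\<^sup>i\<^sub>t\<^sub>i\<close>, their traces meet: otherwise an edge of the
  median graph separates the two convex sets, and it changes only one coordinate \<open>j\<close>, in which both
  traces attain the value \<open>t\<^sub>j\<close>.  By the Helly property all these traces have a common node, whose bag
  contains the whole intersection.
\<close>

section \<open>Graph distances and median graphs\<close>

lemma pair_graph_iff:
  "pair_graph G \<longleftrightarrow> finite (pverts G) \<and> parcs G \<subseteq> pverts G \<times> pverts G \<and> sym (parcs G) \<and> irrefl (parcs G)"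
proof
  assume "pair_graph G"
  then interpret pair_graph G .
  show "finite (pverts G) \<and> parcs G \<subseteq> pverts G \<times> pverts G \<and> sym (parcs G) \<and> irrefl (parcs G)"
    by (auto intro!: symI irreflI dest: in_arcsD1 in_arcsD2 arcs_symmetric no_loops' simp: pair_finite_verts)
next
  assume G: "finite (pverts G) \<and> parcs G \<subseteq> pverts G \<times> pverts G \<and> sym (parcs G) \<and> irrefl (parcs G)"
  then have "finite (parcs G)"
    by (auto intro: finite_subset)
  with G show "pair_graph G"
    by unfold_locales (auto simp: symmetric_def irrefl_def)
qed

lemma connected_induce_subgraph_iff:
  assumes "pair_graph G"
  shows "Digraph_Component.connected (with_proj G \<restriction> S) \<longleftrightarrow>
    S \<noteq> {} \<and> (\<forall>u\<in>S. \<forall>v\<in>S. (u, v) \<in> rtrancl_on S (parcs G))"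
proof -
  have "sym (parcs G)" using assms by (simp add: pair_graph_iff)
  then have "parcs (mk_symmetric (with_proj G \<restriction> S)) = {(u, v) \<in> parcs G. u \<in> S \<and> v \<in> S}"
    by (fastforce simp: parcs_mk_symmetric dest: symD)
  moreover have "rtrancl_on S {(u, v) \<in> parcs G. u \<in> S \<and> v \<in> S} = rtrancl_on S (parcs G)"
  proof (intro equalityI subrelI)
    fix u v assume "(u, v) \<in> rtrancl_on S (parcs G)"
    then show "(u, v) \<in> rtrancl_on S {(u, v) \<in> parcs G. u \<in> S \<and> v \<in> S}"
    proof induct
      case (step x y)
      then show ?case by (intro converse_rtrancl_on_into_rtrancl_on[of x y]) auto
    qed auto
  qed (auto intro: rtrancl_on_mono[rotated 2])
  ultimately show ?thesis
    by (simp add: connected_def strongly_connected_def reachable_def)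
qed

lemma connected_iff:
  assumes "pair_graph G"
  shows "Digraph_Component.connected (with_proj G) \<longleftrightarrow>
    pverts G \<noteq> {} \<and> (\<forall>u\<in>pverts G. \<forall>v\<in>pverts G. (u, v) \<in> rtrancl_on (pverts G) (parcs G))"
proof -
  have "with_proj G \<restriction> pverts G = with_proj G"
    using assms by (auto simp: induce_subgraph_def with_proj_def pair_graph_iff)
  then show ?thesis
    using connected_induce_subgraph_iff[OF assms, of "pverts G"] by simp
qed

text \<open>
  Only the graph distance satisfies these axioms, so an explicit formula for the distance can be
  verified by checking them.
\<close>

locale graph_distance =
  fixes G :: "'a pair_pre_digraph" and \<delta> :: "'a \<Rightarrow> 'a \<Rightarrow> nat"
  assumes pair_graph: "pair_graph G"
    and nonempty: "pverts G \<noteq> {}"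
    and zero_iff: "u \<in> pverts G \<Longrightarrow> v \<in> pverts G \<Longrightarrow> \<delta> u v = 0 \<longleftrightarrow> u = v"
    and lipschitz: "(u, u') \<in> parcs G \<Longrightarrow> v \<in> pverts G \<Longrightarrow> \<delta> u v \<le> \<delta> u' v + 1"
    and descent: "u \<in> pverts G \<Longrightarrow> v \<in> pverts G \<Longrightarrow> u \<noteq> v \<Longrightarrow>
      \<exists>u'. (u, u') \<in> parcs G \<and> \<delta> u v = \<delta> u' v + 1"
begin

lemma finite_verts: "finite (pverts G)"
  using pair_graph by (simp add: pair_graph_iff)

lemma arc_verts: "(u, v) \<in> parcs G \<Longrightarrow> u \<in> pverts G" "(u, v) \<in> parcs G \<Longrightarrow> v \<in> pverts G"
  using pair_graph by (auto simp: pair_graph_iff)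

lemma arc_sym: "(u, v) \<in> parcs G \<Longrightarrow> (v, u) \<in> parcs G"
  using pair_graph by (auto simp: pair_graph_iff dest: symD)

lemma arc_neq: "(u, v) \<in> parcs G \<Longrightarrow> u \<noteq> v"
  using pair_graph by (auto simp: pair_graph_iff irrefl_def)

text \<open>Induction along a shortest path towards the fixed target \<open>v\<close>; it replaces
  explicit walks in the metric arguments below.\<close>

lemma descent_induct [consumes 2, case_names base step]:
  assumes "u \<in> pverts G" "v \<in> pverts G"
    and "P v"
    and "\<And>u u'. (u, u') \<in> parcs G \<Longrightarrow> \<delta> u v = \<delta> u' v + 1 \<Longrightarrow> P u' \<Longrightarrow> P u"
  shows "P u"
  using assms(1)
proof (induction "\<delta> u v" arbitrary: u)
  case 0
  then show ?case using assms(2,3) zero_iff by simp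
next
  case (Suc n)
  then have "u \<noteq> v" using assms(2) zero_iff by fastforce
  then obtain u' where "(u, u') \<in> parcs G" "\<delta> u v = \<delta> u' v + 1"
    using Suc.prems assms(2) descent by blast
  then show ?case
    using Suc assms(4) arc_verts by simp
qed

lemma triangle:
  assumes "u \<in> pverts G" "v \<in> pverts G" "w \<in> pverts G"
  shows "\<delta> u w \<le> \<delta> u v + \<delta> v w"
  using assms(1,2)
proof (induction rule: descent_induct)
  case (step u u')
  then show ?case using lipschitz[of u u' w] assms(3) by simp
qed simp

lemma arc_distance: "(u, v) \<in> parcs G \<Longrightarrow> \<delta> u v = 1"
  using lipschitz[of u v v] zero_iff[of u v] zero_iff[of v v] arc_verts arc_neq by force

lemma distance_one_arc:
  assumes "u \<in> pverts G" "v \<in> pverts G" "\<delta> u v = 1"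
  shows "(u, v) \<in> parcs G"
proof -
  have "u \<noteq> v" using assms zero_iff by force
  then obtain u' where "(u, u') \<in> parcs G" "\<delta> u v = \<delta> u' v + 1"
    using descent assms by blast
  then show ?thesis using assms zero_iff[of u' v] arc_verts by simp
qed

text \<open>Symmetry is not among the axioms. It follows from the symmetry of the arcs, by walking
  from \<open>u\<close> to \<open>v\<close> and paying one for each arc in the reverse
  direction.\<close>

lemma sym_le:
  assumes "u \<in> pverts G" "v \<in> pverts G"
  shows "\<delta> v u \<le> \<delta> u v"
  using assms
proof (induction rule: descent_induct)
  case (step u u')
  then have "\<delta> v u \<le> \<delta> v u' + \<delta> u' u"
    using triangle assms(2) arc_verts by blast
  then show ?case using step arc_distance[OF arc_sym] by fastforce
qed (use assms zero_iff in simp)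

lemma commute: "u \<in> pverts G \<Longrightarrow> v \<in> pverts G \<Longrightarrow> \<delta> u v = \<delta> v u"
  using sym_le by (simp add: le_antisym)

text \<open>The bound covers every vertex of the walk and not just its start, so that it can also
  show that a shortest walk never returns to its start.\<close>

lemma awalk_distance_le:
  assumes "pre_digraph.awalk G u p v" and "x \<in> set (pawalk_verts u p)"
  shows "\<delta> x v \<le> length p"
proof -
  interpret pair_graph G by (rule pair_graph)
  show ?thesis
    using assms
  proof (induction p arbitrary: u x)
    case Nil
    then show ?case using zero_iff by (auto simp: awalk_Nil_iff)
  next
    case (Cons e p)
    then have e: "e \<in> parcs G" "fst e = u" "awalk (snd e) p v" and "v \<in> pverts G"
      by (auto simp: awalk_Cons_iff)
    have "\<delta> (snd e) v \<le> length p"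
      using Cons.IH[OF e(3) hd_in_awalk_verts(1)[OF e(3)]] .
    moreover have "\<delta> u v \<le> \<delta> (snd e) v + 1"
      using lipschitz[of u "snd e" v] e(1,2) \<open>v \<in> pverts G\<close> by (cases e) simp
    moreover have "x = u \<or> x \<in> set (awalk_verts (snd e) p)"
      using Cons.prems(2) e(2) by simp
    ultimately show ?case
      using Cons.IH[OF e(3)] by force
  qed
qed

lemma shortest_awalk_exists:
  assumes "u \<in> pverts G" "v \<in> pverts G"
  shows "\<exists>p. pre_digraph.awalk G u p v \<and> length p = \<delta> u v"
proof -
  interpret pair_graph G by (rule pair_graph)
  show ?thesis
    using assms
  proof (induction rule: descent_induct)
    case base
    have "awalk v [] v" using assms by (simp add: awalk_Nil_iff)
    then show ?case using assms zero_iff by (intro exI[of _ "[]"]) simp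
  next
    case (step u u')
    then obtain p where "awalk u' p v" "length p = \<delta> u' v" by blast
    then have "awalk u ((u, u') # p) v \<and> length ((u, u') # p) = \<delta> u v"
      using step arc_verts by (auto simp: awalk_Cons_iff)
    then show ?case by blast
  qed
qed

text \<open>\<open>\<mu>\<close> is an infimum over all walks: \<open>awalk_distance_le\<close>
  makes \<open>\<delta> u v\<close> a lower bound, and \<open>shortest_awalk_exists\<close> attains
  it.\<close>

lemma gdist_eq:
  assumes "u \<in> pverts G" "v \<in> pverts G"
  shows "gdist G u v = ereal (real (\<delta> u v))"
proof -
  interpret pair_graph G by (rule pair_graph)
  have cost: "awalk_cost (\<lambda>_. 1) p = real (length p)" for p :: "('a \<times> 'a) list"
    by (induction p) auto
  have le: "\<delta> u v \<le> length p" if "awalk u p v" for p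
    using that awalk_distance_le hd_in_awalk_verts(1) by blast
  obtain p where "awalk u p v" "length p = \<delta> u v"
    using shortest_awalk_exists assms by blast
  then show ?thesis
    unfolding gdist_def \<mu>_def cost
    by (intro antisym INF_lower2[of p] INF_greatest) (use le in auto)
qed

text \<open>If the start recurred later, the remaining walk would bound its distance to
  \<open>v\<close> by one less than the length. Shortest walks are therefore the paths that
  \<open>shortest_path\<close> asks for.\<close>

lemma shortest_awalk_apath:
  assumes "pre_digraph.awalk G u p v" "length p = \<delta> u v"
  shows "pre_digraph.apath G u p v"
proof -
  interpret pair_graph G by (rule pair_graph)
  show ?thesis
    using assms
  proof (induction p arbitrary: u)
    case Nil
    then show ?case by (auto simp: awalk_Nil_iff apath_Nil_iff)
  next
    case (Cons e p)
    then have e: "e \<in> parcs G" "fst e = u" "awalk (snd e) p v" and "v \<in> pverts G"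
      by (auto simp: awalk_Cons_iff)
    have le: "\<delta> x v \<le> length p" if "x \<in> set (awalk_verts (snd e) p)" for x
      using awalk_distance_le[OF e(3) that] .
    from le[of u] have "u \<notin> set (awalk_verts (snd e) p)"
      using Cons.prems(2) by auto
    moreover have "\<delta> u v \<le> \<delta> (snd e) v + 1"
      using lipschitz[of u "snd e" v] e(1,2) \<open>v \<in> pverts G\<close> by (cases e) simp
    then have "length p = \<delta> (snd e) v"
      using le[OF hd_in_awalk_verts(1)[OF e(3)]] Cons.prems(2) by simp
    ultimately show ?case
      using Cons.IH e by (auto simp: apath_Cons_iff)
  qed
qed

text \<open>Splitting a shortest path at \<open>w\<close> gives two walks whose lengths bound the
  two distances, and the triangle inequality forces equality. Conversely, shortest walks to and from
  \<open>w\<close> concatenate to a shortest one. From here on, intervals are handled through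
  distances alone.\<close>

lemma in_interval_iff:
  assumes "u \<in> pverts G" "v \<in> pverts G"
  shows "w \<in> interval G u v \<longleftrightarrow> w \<in> pverts G \<and> \<delta> u w + \<delta> w v = \<delta> u v"
proof -
  interpret pair_graph G by (rule pair_graph)
  have sp: "shortest_path G u p v \<longleftrightarrow> awalk u p v \<and> length p = \<delta> u v" for p
    using gdist_eq[OF assms] shortest_awalk_apath by (auto simp: shortest_path_def apath_def)
  show ?thesis
  proof
    assume "w \<in> interval G u v"
    then obtain p where p: "awalk u p v" "length p = \<delta> u v" and w: "w \<in> set (awalk_verts u p)"
      by (auto simp: interval_def sp)
    then obtain q r where "p = q @ r" "awalk u q w" "awalk w r v"
      using awalk_decomp by blast
    moreover have "w \<in> pverts G" using \<open>awalk w r v\<close> by auto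
    moreover have "\<delta> u w \<le> length q" "\<delta> w v \<le> length r"
      using awalk_distance_le hd_in_awalk_verts(1) \<open>awalk u q w\<close> \<open>awalk w r v\<close> by blast+
    ultimately show "w \<in> pverts G \<and> \<delta> u w + \<delta> w v = \<delta> u v"
      using p(2) triangle[OF assms(1) _ assms(2), of w] by auto
  next
    assume w: "w \<in> pverts G \<and> \<delta> u w + \<delta> w v = \<delta> u v"
    then obtain q r where qr: "awalk u q w" "length q = \<delta> u w" "awalk w r v" "length r = \<delta> w v"
      using shortest_awalk_exists assms by meson
    then have "awalk u (q @ r) v" "w \<in> set (awalk_verts u (q @ r))"
      by (auto simp: set_awalk_verts_append hd_in_awalk_verts)
    moreover have "length (q @ r) = \<delta> u v" using qr w by simp
    ultimately show "w \<in> interval G u v"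
      unfolding interval_def awalk_verts_with_proj_eq using sp by blast
  qed
qed

lemma convex_iff:
  "geodesically_convex G S \<longleftrightarrow> S \<subseteq> pverts G \<and>
    (\<forall>u\<in>S. \<forall>v\<in>S. \<forall>w\<in>pverts G. \<delta> u w + \<delta> w v = \<delta> u v \<longrightarrow> w \<in> S)"
  unfolding geodesically_convex_def using in_interval_iff by blast

lemma connected: "Digraph_Component.connected (with_proj G)"
  unfolding connected_iff[OF pair_graph]
proof (intro conjI ballI)
  fix u v assume uv: "u \<in> pverts G" "v \<in> pverts G"
  then show "(u, v) \<in> rtrancl_on (pverts G) (parcs G)"
    by (induction rule: descent_induct)
      (use uv arc_verts in \<open>auto intro: converse_rtrancl_on_into_rtrancl_on\<close>)
qed (rule nonempty)

definition median_of :: "'a \<Rightarrow> 'a \<Rightarrow> 'a \<Rightarrow> 'a \<Rightarrow> bool" where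
  "median_of u v w m \<longleftrightarrow> m \<in> pverts G \<and> \<delta> u m + \<delta> m v = \<delta> u v \<and>
     \<delta> v m + \<delta> m w = \<delta> v w \<and> \<delta> w m + \<delta> m u = \<delta> w u"

lemma median_graph_iff:
  "median_graph G \<longleftrightarrow> (\<forall>u\<in>pverts G. \<forall>v\<in>pverts G. \<forall>w\<in>pverts G. \<exists>!m. median_of u v w m)"
proof -
  have "interval G u v \<inter> interval G v w \<inter> interval G w u = Collect (median_of u v w)"
    if "u \<in> pverts G" "v \<in> pverts G" "w \<in> pverts G" for u v w
    using that by (auto simp: in_interval_iff median_of_def)
  moreover have "card (Collect P) = 1 \<longleftrightarrow> (\<exists>!x. P x)" for P :: "'a \<Rightarrow> bool"
    unfolding One_nat_def card_1_singleton_iff by (auto simp: set_eq_iff) 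
  ultimately show ?thesis
    using pair_graph connected by (simp add: median_graph_def)
qed

end

text \<open>The witness is the least length of a walk. Prepending an arc gives
  \<open>lipschitz\<close>, and removing the first arc of a shortest walk gives
  \<open>descent\<close>.\<close>

lemma graph_distance_exists:
  assumes "pair_graph G" "Digraph_Component.connected (with_proj G)"
  shows "\<exists>\<delta>. graph_distance G \<delta>"
proof -
  interpret pair_graph G by fact
  define \<delta> where "\<delta> u v = (LEAST n. \<exists>p. awalk u p v \<and> length p = n)" for u v
  have walk: "\<exists>p. awalk u p v \<and> length p = \<delta> u v" if uv: "u \<in> pverts G" "v \<in> pverts G" for u v
  proof -
    have "(u, v) \<in> rtrancl_on (pverts G) (parcs G)"
      using uv assms connected_iff by blast
    then have "\<exists>p. awalk u p v"
      using reachable_awalk by (simp add: reachable_def)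
    then have "\<exists>n p. awalk u p v \<and> length p = n" by blast
    then show ?thesis unfolding \<delta>_def by (rule LeastI_ex)
  qed
  have le: "\<delta> u v \<le> length p" if "awalk u p v" for u v p
    unfolding \<delta>_def using that by (blast intro: Least_le)
  have "graph_distance G \<delta>"
  proof
    show "pverts G \<noteq> {}" using assms connected_iff by blast
  next
    fix u v assume uv: "u \<in> pverts G" "v \<in> pverts G"
    show "\<delta> u v = 0 \<longleftrightarrow> u = v"
      using walk[OF uv] le[of u "[]" v] uv by (auto simp: awalk_Nil_iff)
    assume "u \<noteq> v"
    obtain p where p: "awalk u p v" "length p = \<delta> u v" using walk[OF uv] by blast
    then obtain e q where q: "p = e # q" "e \<in> parcs G" "fst e = u" "awalk (snd e) q v"
      using \<open>u \<noteq> v\<close> by (cases p) (auto simp: awalk_Nil_iff awalk_Cons_iff)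
    have arc: "(u, snd e) \<in> parcs G" using q(2,3) by (cases e) simp
    then obtain r where r: "awalk (snd e) r v" "length r = \<delta> (snd e) v"
      using walk uv in_arcsD2 by blast
    then have "awalk u ((u, snd e) # r) v"
      using arc in_arcsD1 by (auto simp: awalk_Cons_iff)
    then have "\<delta> u v \<le> \<delta> (snd e) v + 1"
      using le[of u "(u, snd e) # r" v] r(2) by simp
    then have "\<delta> u v = \<delta> (snd e) v + 1" using le[OF q(4)] p q by simp
    with arc show "\<exists>u'. (u, u') \<in> parcs G \<and> \<delta> u v = \<delta> u' v + 1" by blast
  next
    fix u u' v assume arc: "(u, u') \<in> parcs G" and v: "v \<in> pverts G"
    then obtain r where r: "awalk u' r v" "length r = \<delta> u' v"
      using walk in_arcsD2 by blast
    then have "awalk u ((u, u') # r) v"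
      using arc in_arcsD1 by (auto simp: awalk_Cons_iff)
    then show "\<delta> u v \<le> \<delta> u' v + 1"
      using le[of u "(u, u') # r" v] r(2) by simp
  qed
  then show ?thesis by blast
qed

section \<open>Convex sets and the Helly property of median graphs\<close>

lemma (in graph_distance) convex_verts: "geodesically_convex G S \<Longrightarrow> S \<subseteq> pverts G"
  by (simp add: geodesically_convex_def)

lemma (in graph_distance) convex_between:
  "geodesically_convex G S \<Longrightarrow> u \<in> S \<Longrightarrow> v \<in> S \<Longrightarrow> w \<in> pverts G \<Longrightarrow> \<delta> u w + \<delta> w v = \<delta> u v \<Longrightarrow> w \<in> S"
  using convex_iff by blast

text \<open>Induction on the family, replacing each \<open>C i\<close> by
  \<open>C i \<inter> C k\<close>. These sets still meet pairwise: choose a vertex in each pairwise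
  intersection of \<open>C i\<close>, \<open>C j\<close>, \<open>C k\<close>; the median of the
  three lies between two vertices of each set. The case \<open>i = j\<close> of the last hypothesis
  makes every set non-empty.\<close>

lemma (in graph_distance) Helly:
  assumes "median_graph G" and "finite I" and "\<And>i. i \<in> I \<Longrightarrow> geodesically_convex G (C i)"
    and "\<And>i j. i \<in> I \<Longrightarrow> j \<in> I \<Longrightarrow> C i \<inter> C j \<noteq> {}"
  shows "\<exists>x\<in>pverts G. \<forall>i\<in>I. x \<in> C i"
  using assms(2-4)
proof (induction I arbitrary: C rule: finite_induct)
  case empty
  show ?case using nonempty by blast
next
  case (insert k I)
  have conv: "geodesically_convex G (C i)" if "i \<in> insert k I" for i
    using that by (rule insert.prems(1))
  show ?case
  \<comment> \<open>For empty \<open>I\<close> the induction hypothesis would yield a vertex that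
    need not lie in \<open>C k\<close>.\<close>
  proof (cases "I = {}")
    case True
    have "C k \<inter> C k \<noteq> {}" by (rule insert.prems(2)) simp_all
    then obtain x where "x \<in> C k" by blast
    then show ?thesis using True convex_verts[OF conv, of k] by auto
  next
    case False
    have "\<exists>x\<in>pverts G. \<forall>i\<in>I. x \<in> C i \<inter> C k"
    proof (rule insert.IH)
      fix i assume "i \<in> I"
      then show "geodesically_convex G (C i \<inter> C k)"
        using conv[of i] conv[of k] unfolding geodesically_convex_def by blast
    next
      fix i j assume ij: "i \<in> I" "j \<in> I"
      then have "C i \<inter> C j \<noteq> {}" "C j \<inter> C k \<noteq> {}" "C i \<inter> C k \<noteq> {}"
        by (simp_all add: insert.prems(2))
      then obtain u v w where uvw: "u \<in> C i" "u \<in> C j" "v \<in> C j" "v \<in> C k" "w \<in> C i" "w \<in> C k"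
        by blast
      have verts: "u \<in> pverts G" "v \<in> pverts G" "w \<in> pverts G"
        using uvw convex_verts[OF conv, of j] convex_verts[OF conv, of k] ij by auto
      then obtain m where m: "median_of u v w m"
        using assms(1) median_graph_iff by blast
      have "m \<in> C j" using convex_between[OF conv, of j u v m] uvw ij m by (simp add: median_of_def)
      moreover have "m \<in> C k" using convex_between[OF conv, of k v w m] uvw m by (simp add: median_of_def)
      moreover have "m \<in> C i" using convex_between[OF conv, of i w u m] uvw ij m by (simp add: median_of_def)
      ultimately show "C i \<inter> C k \<inter> (C j \<inter> C k) \<noteq> {}" by blast
    qed
    then show ?thesis using False by auto
  qed
qed

section \<open>Trees\<close>

locale tree_distance = graph_distance T \<delta>
  for T :: "'a pair_pre_digraph" and \<delta> +
  assumes tree: "undirected_tree T"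
begin

text \<open>A walk from \<open>y\<close> to \<open>z\<close> avoiding \<open>x\<close>, shortened to
  a path and closed through \<open>x\<close>, would be a forbidden cycle. The tree properties below
  draw on acyclicity through this lemma.\<close>

lemma no_detour:
  assumes "(x, y) \<in> parcs T" "(x, z) \<in> parcs T" and "(y, z) \<in> rtrancl_on (pverts T - {x}) (parcs T)"
  shows "y = z"
proof (rule ccontr)
  assume "y \<noteq> z"
  interpret pair_graph T by (rule pair_graph)
  \<comment> \<open>Avoidance is recorded on the heads of the arcs, as it then survives the passage
    to a path that uses a subset of the arcs.\<close>
  from assms(3) have "\<exists>p. awalk y p z \<and> x \<notin> snd ` set p"
  proof (induction rule: rtrancl_on_induct)
    case base
    then have "awalk y [] y" by (simp add: awalk_Nil_iff)
    then show ?case by force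
  next
    case (step u v)
    then obtain p where p: "awalk y p u" "x \<notin> snd ` set p" by blast
    moreover have "awalk u [(u, v)] v"
      using step arc_verts by (simp add: awalk_Cons_iff awalk_Nil_iff)
    ultimately have "awalk y (p @ [(u, v)]) v" using awalk_appendI by blast
    moreover have "x \<notin> snd ` set (p @ [(u, v)])"
      using p(2) step.hyps by auto
    ultimately show ?case by blast
  qed
  then obtain p where p: "awalk y p z" "x \<notin> snd ` set p" by blast
  define q where "q = awalk_to_apath p"
  have q: "apath y q z" "x \<notin> snd ` set q"
    using apath_awalk_to_apath[OF p(1)] awalk_to_apath_subset[OF p(1)] p(2) by (auto simp: q_def)
  \<comment> \<open>This gives the closed walk at least three arcs, so that it is not merely an edge
    traversed back and forth.\<close>
  then have "q \<noteq> []" using \<open>y \<noteq> z\<close> by (auto simp: apath_Nil_iff)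
  have walk: "awalk x ((x, y) # q @ [(z, x)]) x"
    using assms(1,2) q(1) arc_verts arc_sym
    by (auto simp: apath_def awalk_Cons_iff awalk_Nil_iff)
  have "awalk y q z" "distinct (awalk_verts y q)" using q(1) by (auto simp: apath_def)
  then have set_q: "set (awalk_verts y q) = insert y (snd ` set q)"
    using set_awalk_verts[of y q z] arg_cong[OF awalk_verts_conv'[of y q z], of set] \<open>q \<noteq> []\<close>
    by (cases q) (auto simp: awalk_Cons_iff)
  have "awalk_verts x ((x, y) # q @ [(z, x)]) = x # awalk_verts y q @ [x]"
    using \<open>awalk y q z\<close> walk \<open>q \<noteq> []\<close>
    by (auto simp: awalk_verts_conv awalk_Cons_iff)
  then have "cycle ((x, y) # q @ [(z, x)])"
    using walk \<open>distinct (awalk_verts y q)\<close> set_q q(2) arc_neq[OF assms(1)]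
    by (auto simp: cycle_def)
  moreover have "3 \<le> length ((x, y) # q @ [(z, x)])"
    using \<open>q \<noteq> []\<close> by (cases q) auto
  ultimately show False
    using tree unfolding undirected_tree_def by blast
qed

text \<open>Along a shortest path from \<open>y\<close> to \<open>c\<close> the distance to
  \<open>c\<close> strictly decreases, so after \<open>y\<close> every vertex is closer to
  \<open>c\<close> than \<open>x\<close> is.\<close>

lemma geodesic_avoids:
  assumes "y \<in> pverts T" "c \<in> pverts T" "y \<noteq> x" "\<delta> y c \<le> \<delta> x c"
  shows "(y, c) \<in> rtrancl_on (pverts T - {x}) (parcs T)"
  using assms(1,2,3,4)
proof (induction rule: descent_induct)
  case base
  then show ?case using assms(2) by auto
next
  case (step u u')
  then have "u' \<noteq> x" by auto
  with step have "(u', c) \<in> rtrancl_on (pverts T - {x}) (parcs T)" by simp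
  then show ?case
    using step arc_verts by (intro converse_rtrancl_on_into_rtrancl_on[of u u']) auto
qed

lemma avoiding_sym:
  "(u, v) \<in> rtrancl_on F (parcs T) \<Longrightarrow> (v, u) \<in> rtrancl_on F (parcs T)"
  using rtrancl_on_sym[of "parcs T" F] pair_graph by (auto simp: pair_graph_iff dest: symD)

text \<open>Shortest paths from \<open>y\<close> and \<open>z\<close> to \<open>c\<close> both avoid
  \<open>x\<close> and join to a detour. The weak inequalities also exclude a neighbour at the same
  distance from \<open>c\<close> as \<open>x\<close>, next to the one that is closer.\<close>

lemma parent_unique:
  assumes "(x, y) \<in> parcs T" "(x, z) \<in> parcs T" "c \<in> pverts T" "\<delta> y c \<le> \<delta> x c" "\<delta> z c \<le> \<delta> x c"
  shows "y = z"
proof (rule no_detour[OF assms(1,2)])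
  have "(y, c) \<in> rtrancl_on (pverts T - {x}) (parcs T)" "(z, c) \<in> rtrancl_on (pverts T - {x}) (parcs T)"
    using assms arc_verts arc_neq by (blast intro: geodesic_avoids)+
  then show "(y, z) \<in> rtrancl_on (pverts T - {x}) (parcs T)"
    by (meson avoiding_sym rtrancl_on_trans)
qed

text \<open>A path that has begun to move away from \<open>w\<close> cannot turn back:
  \<open>x\<close> is the only neighbour of \<open>y\<close> that is not farther from
  \<open>w\<close>, so the next vertex towards \<open>u\<close> is farther again.\<close>

lemma geodesic_extend:
  assumes "y \<in> pverts T" "u \<in> pverts T" "w \<in> pverts T"
    and "(x, y) \<in> parcs T" "\<delta> x w < \<delta> y w" "\<delta> x u = \<delta> y u + 1"
  shows "\<delta> y w + \<delta> y u = \<delta> u w"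
proof -
  \<comment> \<open>The predecessor \<open>x\<close> is generalised because it advances together
    with \<open>y\<close>.\<close>
  have "\<forall>x. (x, y) \<in> parcs T \<longrightarrow> \<delta> x w < \<delta> y w \<longrightarrow> \<delta> x u = \<delta> y u + 1 \<longrightarrow> \<delta> y w + \<delta> y u = \<delta> u w"
    using assms(1,2)
  proof (induction rule: descent_induct)
    case base
    then show ?case using assms(2) zero_iff by simp
  next
    case (step y y')
    show ?case
    proof (intro allI impI)
      fix x assume x: "(x, y) \<in> parcs T" "\<delta> x w < \<delta> y w" "\<delta> x u = \<delta> y u + 1"
      have "x \<noteq> y'" using step x by auto
      then have "\<delta> y w < \<delta> y' w"
        using parent_unique[OF arc_sym[OF x(1)] step(1) assms(3)] x by force
      moreover have "\<delta> y' w \<le> \<delta> y w + 1"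
        using lipschitz[OF arc_sym[OF step(1)] assms(3)] .
      ultimately show "\<delta> y w + \<delta> y u = \<delta> u w"
        using step by auto
    qed
  qed
  then show ?thesis using assms by blast
qed

text \<open>Induction from \<open>m\<close> towards \<open>v\<close>: the successors
  \<open>n\<close> and \<open>n'\<close> of \<open>m\<close> and \<open>m'\<close> coincide, and
  \<open>m\<close> and \<open>m'\<close> are both neighbours of \<open>n\<close> towards
  \<open>u\<close>, of which there is only one by \<open>parent_unique\<close>.\<close>

lemma interval_unique:
  assumes "m \<in> pverts T" "v \<in> pverts T" "u \<in> pverts T" "m' \<in> pverts T"
    and "\<delta> m u + \<delta> m v = \<delta> v u" "\<delta> m' u + \<delta> m' v = \<delta> v u" "\<delta> m u = \<delta> m' u"
  shows "m = m'"
proof -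
  have "\<forall>m'\<in>pverts T. \<delta> m u + \<delta> m v = \<delta> v u \<longrightarrow> \<delta> m' u + \<delta> m' v = \<delta> v u \<longrightarrow> \<delta> m u = \<delta> m' u \<longrightarrow> m = m'"
    using assms(1,2)
  proof (induction rule: descent_induct)
    case base
    then show ?case using assms(2) zero_iff by auto
  next
    case (step m n)
    show ?case
    proof (intro ballI impI)
      fix m' assume m': "m' \<in> pverts T"
        and eq: "\<delta> m u + \<delta> m v = \<delta> v u" "\<delta> m' u + \<delta> m' v = \<delta> v u" "\<delta> m u = \<delta> m' u"
      then have "m' \<noteq> v" using step zero_iff[of v v] assms(2) by auto
      then obtain n' where n': "(m', n') \<in> parcs T" "\<delta> m' v = \<delta> n' v + 1"
        using descent m' assms(2) by blast
      have le: "\<delta> v u \<le> \<delta> n u + \<delta> n v" "\<delta> v u \<le> \<delta> n' u + \<delta> n' v"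
        using triangle[of v n u] triangle[of v n' u] commute[of v n] commute[of v n']
          arc_verts(2)[OF step(1)] arc_verts(2)[OF n'(1)] assms(2,3) by simp_all
      have "\<delta> n u \<le> \<delta> m u + 1" "\<delta> n' u \<le> \<delta> m' u + 1"
        using lipschitz[OF arc_sym[OF step(1)] assms(3)] lipschitz[OF arc_sym[OF n'(1)] assms(3)]
        by simp_all
      then have n: "\<delta> n u = \<delta> m u + 1" "\<delta> n' u = \<delta> m' u + 1"
        using le eq step(2) n'(2) by linarith+
      then have "n = n'"
        using step(3) eq step(2) n' arc_verts(2)[OF n'(1)] by auto
      then show "m = m'"
        using parent_unique[OF arc_sym[OF step(1)] arc_sym, of m' u] n' n eq assms(3) by simp
    qed
  qed
  then show ?thesis using assms by blast
qed

text \<open>The median is a vertex \<open>m\<close> of the interval between \<open>u\<close> and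
  \<open>v\<close> that is closest to \<open>w\<close>. By minimality, the first steps from
  \<open>m\<close> towards \<open>u\<close> and \<open>v\<close> lead away from \<open>w\<close>, so
  \<open>geodesic_extend\<close> puts \<open>m\<close> on the shortest paths from \<open>w\<close>
  to both.\<close>

lemma median_graph: "median_graph T"
  unfolding median_graph_iff
proof (intro ballI ex_ex1I)
  fix u v w assume V: "u \<in> pverts T" "v \<in> pverts T" "w \<in> pverts T"
  define I where "I = {x \<in> pverts T. \<delta> u x + \<delta> x v = \<delta> u v}"
  have "finite I" "I \<noteq> {}"
    using finite_verts V zero_iff[of u u] by (auto simp: I_def intro!: exI[of _ u])
  then obtain m where m: "m \<in> I" and min: "\<And>x. x \<in> I \<Longrightarrow> \<delta> m w \<le> \<delta> x w"
    using arg_min_if_finite[of I "\<lambda>x. \<delta> x w"] arg_min_least[of I _ "\<lambda>x. \<delta> x w"] by blast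
  have mV: "m \<in> pverts T" using m by (simp add: I_def)
  \<comment> \<open>Applied with \<open>c\<close> equal to \<open>u\<close> and to \<open>v\<close>;
    the second premise says that shortest paths from \<open>m\<close> to \<open>c\<close> stay in
    \<open>I\<close>.\<close>
  have toward: "\<delta> m w + \<delta> m c = \<delta> c w"
    if c: "c \<in> pverts T" and I: "\<And>x. x \<in> pverts T \<Longrightarrow> \<delta> m x + \<delta> x c = \<delta> m c \<Longrightarrow> x \<in> I" for c
  proof (cases "m = c")
    case True
    then show ?thesis using c zero_iff by simp
  next
    case False
    then obtain x where x: "(m, x) \<in> parcs T" "\<delta> m c = \<delta> x c + 1"
      using descent mV c by blast
    then have xV: "x \<in> pverts T" using arc_verts by blast
    have "x \<in> I" using I[OF xV] x arc_distance by simp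
    then have "\<delta> m w \<le> \<delta> x w" using min by blast
    \<comment> \<open>A tie is impossible: the neighbour \<open>p\<close> of \<open>m\<close>
      towards \<open>w\<close> would have to be \<open>x\<close>, which is not closer to
      \<open>w\<close>.\<close>
    moreover have "\<delta> x w \<noteq> \<delta> m w"
    proof
      assume eq: "\<delta> x w = \<delta> m w"
      have "w \<noteq> m" using eq zero_iff[OF mV V(3)] zero_iff[OF xV V(3)] arc_neq[OF x(1)] by auto
      then obtain p where p: "(m, p) \<in> parcs T" "\<delta> m w = \<delta> p w + 1"
        using descent mV V by blast
      then have "p = x" using parent_unique[OF p(1) x(1) V(3)] eq by simp
      then show False using p eq by simp
    qed
    ultimately have "\<delta> x w + \<delta> x c = \<delta> c w"
      using geodesic_extend[OF xV c V(3) x(1)] x(2) by simp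
    moreover have "\<delta> x w \<le> \<delta> m w + 1" using lipschitz[OF arc_sym[OF x(1)] V(3)] .
    ultimately show ?thesis
      using x(2) \<open>\<delta> m w \<le> \<delta> x w\<close> \<open>\<delta> x w \<noteq> \<delta> m w\<close> by simp
  qed
  have "x \<in> I" if "x \<in> pverts T" "\<delta> m x + \<delta> x u = \<delta> m u" for x
    using that m V mV triangle[of u x v] triangle[of x m v] commute[of u x] commute[of x m] commute[of u m]
    by (auto simp: I_def)
  then have wu: "\<delta> m w + \<delta> m u = \<delta> u w" using toward V by blast
  have "x \<in> I" if "x \<in> pverts T" "\<delta> m x + \<delta> x v = \<delta> m v" for x
    using that m V mV triangle[of u x v] triangle[of u m x]
    by (auto simp: I_def)
  then have wv: "\<delta> m w + \<delta> m v = \<delta> v w" using toward V by blast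
  have "median_of u v w m"
    using wu wv m V mV commute[of m w] commute[of m v] commute[of w u] commute[of m u] unfolding median_of_def I_def
    by simp
  then show "\<exists>m. median_of u v w m" by blast
next
  fix u v w m m' assume V: "u \<in> pverts T" "v \<in> pverts T" "w \<in> pverts T"
    and med: "median_of u v w m" "median_of u v w m'"
  show "m = m'"
  proof (rule interval_unique)
    show "m \<in> pverts T" "m' \<in> pverts T" "v \<in> pverts T" "u \<in> pverts T"
      using med V by (auto simp: median_of_def)
    \<comment> \<open>The three equations of a median determine its distance from \<open>u\<close>:
      twice that distance is \<open>\<delta> u v + \<delta> u w - \<delta> v w\<close>.\<close>
    then show "\<delta> m u + \<delta> m v = \<delta> v u" "\<delta> m' u + \<delta> m' v = \<delta> v u" "\<delta> m u = \<delta> m' u"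
      using med V(3) commute[of u v] commute[of u w] commute[of u m] commute[of v m] commute[of w m]
        commute[of u m'] commute[of v m'] commute[of w m']
      unfolding median_of_def by linarith+
  qed
qed

text \<open>Suppose \<open>x\<close> lies between \<open>u\<close> and \<open>v\<close> but outside
  \<open>S\<close>. Its neighbours towards \<open>u\<close> and \<open>v\<close> are joined through
  \<open>S\<close> without using \<open>x\<close>, so they coincide by \<open>no_detour\<close>, and
  bypassing \<open>x\<close> shortens the distance from \<open>u\<close> to
  \<open>v\<close>.\<close>

lemma convex_if_connected:
  assumes "S \<subseteq> pverts T" "Digraph_Component.connected (with_proj T \<restriction> S)"
  shows "geodesically_convex T S"
  unfolding convex_iff
proof (intro conjI ballI impI)
  fix u v x assume uv: "u \<in> S" "v \<in> S" and x: "x \<in> pverts T" "\<delta> u x + \<delta> x v = \<delta> u v"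
  show "x \<in> S"
  proof (rule ccontr)
    assume "x \<notin> S"
    have V: "u \<in> pverts T" "v \<in> pverts T" "x \<noteq> u" "x \<noteq> v"
      using assms(1) uv \<open>x \<notin> S\<close> by auto
    then obtain y z where y: "(x, y) \<in> parcs T" "\<delta> x u = \<delta> y u + 1"
      and z: "(x, z) \<in> parcs T" "\<delta> x v = \<delta> z v + 1"
      using descent x(1) by blast
    have yz: "y \<in> pverts T" "z \<in> pverts T" using y z arc_verts by auto
    have "(y, u) \<in> rtrancl_on (pverts T - {x}) (parcs T)" "(z, v) \<in> rtrancl_on (pverts T - {x}) (parcs T)"
      using yz V y z arc_neq[of x] by (auto intro!: geodesic_avoids)
    moreover have "(u, v) \<in> rtrancl_on (pverts T - {x}) (parcs T)"
      using rtrancl_on_mono[OF order_refl, of S "pverts T - {x}" u v "parcs T"] assms uv \<open>x \<notin> S\<close>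
      by (auto simp: connected_induce_subgraph_iff[OF pair_graph])
    ultimately have "(y, z) \<in> rtrancl_on (pverts T - {x}) (parcs T)"
      by (meson avoiding_sym rtrancl_on_trans)
    then have "y = z" using no_detour y(1) z(1) by simp
    then show False
      using triangle[of u y v] commute[of u y] commute[of u x] x yz V y z by simp
  qed
qed (rule assms(1))

end

lemma tree_distance_exists: "undirected_tree T \<Longrightarrow> \<exists>\<delta>. tree_distance T \<delta>"
  using graph_distance_exists[of T]
  by (auto simp: undirected_tree_def tree_distance_def tree_distance_axioms_def)

section \<open>Isometric embeddings and Cartesian products\<close>

lemma isometric_embedding_iff:
  assumes "graph_distance G \<delta>" "graph_distance H \<epsilon>"
  shows "isometric_embedding G H f \<longleftrightarrow> f \<in> pverts G \<rightarrow> pverts H \<and>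
    (\<forall>u\<in>pverts G. \<forall>v\<in>pverts G. \<epsilon> (f u) (f v) = \<delta> u v)"
proof -
  interpret G: graph_distance G \<delta> by fact
  interpret H: graph_distance H \<epsilon> by fact
  show ?thesis
    unfolding isometric_embedding_def by (auto simp: G.gdist_eq H.gdist_eq Pi_iff)
qed

lemma convex_vimage:
  assumes "graph_distance G \<delta>" "graph_distance H \<epsilon>" "isometric_embedding G H f" "geodesically_convex H S"
  shows "geodesically_convex G {u \<in> pverts G. f u \<in> S}"
proof -
  interpret G: graph_distance G \<delta> by fact
  interpret H: graph_distance H \<epsilon> by fact
  have f: "f u \<in> pverts H" "\<epsilon> (f u) (f v) = \<delta> u v" if "u \<in> pverts G" "v \<in> pverts G" for u v
    using that assms(3) by (auto simp: isometric_embedding_iff[OF assms(1,2)])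
  show ?thesis
    unfolding G.convex_iff
  proof (intro conjI ballI impI)
    fix u v w assume "u \<in> {u \<in> pverts G. f u \<in> S}" "v \<in> {u \<in> pverts G. f u \<in> S}"
      and w: "w \<in> pverts G" "\<delta> u w + \<delta> w v = \<delta> u v"
    then have "u \<in> pverts G" "f u \<in> S" "v \<in> pverts G" "f v \<in> S" by auto
    with w have "f w \<in> S"
      using H.convex_between[OF assms(4), of "f u" "f v" "f w"] by (simp add: f)
    with w show "w \<in> {u \<in> pverts G. f u \<in> S}" by simp
  qed auto
qed

text \<open>Medians are described by distances alone. Surjectivity of \<open>f\<close> brings the
  median of the images back to \<open>G\<close>, and injectivity keeps it unique.\<close>

lemma median_graph_isometric:
  assumes "graph_distance G \<delta>" "graph_distance H \<epsilon>" "isometric_embedding G H f"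
    and "bij_betw f (pverts G) (pverts H)" "median_graph H"
  shows "median_graph G"
proof -
  interpret G: graph_distance G \<delta> by fact
  interpret H: graph_distance H \<epsilon> by fact
  have f: "f u \<in> pverts H" "\<epsilon> (f u) (f v) = \<delta> u v" if "u \<in> pverts G" "v \<in> pverts G" for u v
    using that assms(3) by (auto simp: isometric_embedding_iff[OF assms(1,2)])
  show ?thesis
    unfolding G.median_graph_iff
  proof (intro ballI)
    fix u v w assume V: "u \<in> pverts G" "v \<in> pverts G" "w \<in> pverts G"
    have iff: "G.median_of u v w m \<longleftrightarrow> H.median_of (f u) (f v) (f w) (f m)" if "m \<in> pverts G" for m
      using V that by (simp add: G.median_of_def H.median_of_def f)
    have ex1: "\<exists>!y. H.median_of (f u) (f v) (f w) y"
      using assms(5) V f(1) unfolding H.median_graph_iff by blast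
    then obtain y where y: "H.median_of (f u) (f v) (f w) y"
      by blast
    have unique: "y' = y" if "H.median_of (f u) (f v) (f w) y'" for y'
      using ex1 y that by blast
    from y have "y \<in> pverts H" by (simp add: H.median_of_def)
    then have "y \<in> f ` pverts G" using assms(4) by (simp add: bij_betw_def)
    then obtain m where m: "m \<in> pverts G" "f m = y" by blast
    show "\<exists>!m. G.median_of u v w m"
    proof (rule ex1I[of _ m])
      show "G.median_of u v w m" using iff m y by simp
    next
      fix m' assume m': "G.median_of u v w m'"
      then have "m' \<in> pverts G" by (simp add: G.median_of_def)
      then have "f m' = f m" using iff m' m(2) unique by blast
      then show "m' = m"
        using \<open>m' \<in> pverts G\<close> m(1) assms(4) unfolding bij_betw_def by (blast dest: inj_onD)
    qed
  qed
qed

text \<open>Decompositions have nodes of type \<open>nat\<close>, whereas the vertices of a product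
  are functions; this transfers a product to the required type together with its distance.\<close>

lemma graph_distance_nat_copy:
  assumes "graph_distance G \<delta>"
  shows "\<exists>(M :: nat pair_pre_digraph) f. bij_betw f (pverts M) (pverts G) \<and>
    graph_distance M (\<lambda>a b. \<delta> (f a) (f b))"
proof -
  interpret graph_distance G \<delta> by fact
  obtain f where f: "bij_betw f {0..<card (pverts G)} (pverts G)"
    using ex_bij_betw_nat_finite[OF finite_verts] by blast
  define V where "V = {0..<card (pverts G)}"
  define M where "M = \<lparr>pverts = V, parcs = {(a, b). a \<in> V \<and> b \<in> V \<and> (f a, f b) \<in> parcs G}\<rparr>"
  have M: "pverts M = V" "\<And>a b. (a, b) \<in> parcs M \<longleftrightarrow> a \<in> V \<and> b \<in> V \<and> (f a, f b) \<in> parcs G"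
    by (auto simp: M_def)
  have inj: "inj_on f V" and img: "f ` V = pverts G"
    using f by (auto simp: V_def bij_betw_def)
  have fV: "f a \<in> pverts G" if "a \<in> V" for a
    using that img by blast
  have "graph_distance M (\<lambda>a b. \<delta> (f a) (f b))"
  proof (rule graph_distance.intro)
    have "finite V" by (simp add: V_def)
    then have "finite (pverts M)" by (simp add: M(1))
    moreover have "parcs M \<subseteq> pverts M \<times> pverts M" by (auto simp: M_def)
    moreover have "sym (parcs M)" by (rule symI) (simp add: M(2) arc_sym)
    moreover have "irrefl (parcs M)" using arc_neq by (auto simp: irrefl_def M(2))
    ultimately show "pair_graph M" by (simp add: pair_graph_iff)
    show "pverts M \<noteq> {}" using nonempty img by (auto simp: M)
  next
    fix a b assume "a \<in> pverts M" "b \<in> pverts M"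
    then show "\<delta> (f a) (f b) = 0 \<longleftrightarrow> a = b"
      using inj zero_iff fV by (auto simp: M dest: inj_onD)
  next
    fix a a' b assume "(a, a') \<in> parcs M" "b \<in> pverts M"
    then show "\<delta> (f a) (f b) \<le> \<delta> (f a') (f b) + 1"
      using lipschitz fV unfolding M by blast
  next
    fix a b assume ab: "a \<in> pverts M" "b \<in> pverts M" "a \<noteq> b"
    then have "f a \<noteq> f b" using inj by (auto simp: M dest: inj_onD)
    then obtain u where u: "(f a, u) \<in> parcs G" "\<delta> (f a) (f b) = \<delta> u (f b) + 1"
      using descent fV ab M(1) by blast
    have "u \<in> f ` V" using img arc_verts(2)[OF u(1)] by simp
    then obtain a' where "a' \<in> V" "f a' = u" by blast
    with u ab show "\<exists>a'. (a, a') \<in> parcs M \<and> \<delta> (f a) (f b) = \<delta> (f a') (f b) + 1"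
      by (intro exI[of _ a']) (simp add: M)
  qed
  with f M(1) show ?thesis unfolding V_def by metis
qed

section \<open>Cartesian products: distances, medians and convex boxes\<close>

lemma cartesian_product_simps:
  "pverts (cartesian_product k H) = (\<Pi>\<^sub>E j\<in>{..<k}. pverts (H j))"
  "(x, y) \<in> parcs (cartesian_product k H) \<longleftrightarrow>
     x \<in> (\<Pi>\<^sub>E j\<in>{..<k}. pverts (H j)) \<and> y \<in> (\<Pi>\<^sub>E j\<in>{..<k}. pverts (H j)) \<and>
     (\<exists>j<k. (x j, y j) \<in> parcs (H j) \<and> (\<forall>l<k. l \<noteq> j \<longrightarrow> x l = y l))"
  by (simp_all add: cartesian_product_def)

locale product_distance =
  fixes k :: nat and H :: "nat \<Rightarrow> 'a pair_pre_digraph" and d :: "nat \<Rightarrow> 'a \<Rightarrow> 'a \<Rightarrow> nat"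
  assumes factor: "j < k \<Longrightarrow> graph_distance (H j) (d j)"
begin

abbreviation D :: "(nat \<Rightarrow> 'a) \<Rightarrow> (nat \<Rightarrow> 'a) \<Rightarrow> nat" where
  "D x y \<equiv> \<Sum>j<k. d j (x j) (y j)"

lemma product_in_verts:
  "x \<in> pverts (cartesian_product k H) \<Longrightarrow> j < k \<Longrightarrow> x j \<in> pverts (H j)"
  by (auto simp: cartesian_product_simps)

lemma sum_remove: "j < k \<Longrightarrow> D x y = d j (x j) (y j) + (\<Sum>l\<in>{..<k} - {j}. d l (x l) (y l))"
  by (subst sum.remove[of _ j]) auto

text \<open>An arc of the product alters a single summand of \<open>D\<close>, and by at most one.
  For \<open>descent\<close>, one coordinate in which the tuples differ is moved a step closer in
  its factor.\<close>

lemma graph_distance: "graph_distance (cartesian_product k H) D"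
proof (rule graph_distance.intro)
  have G: "pair_graph (H j)" if "j < k" for j
    using factor[OF that] by (rule graph_distance.pair_graph)
  have "finite (pverts (cartesian_product k H))"
    using G by (auto simp: cartesian_product_simps pair_graph_iff intro: finite_PiE)
  moreover have "parcs (cartesian_product k H) \<subseteq> pverts (cartesian_product k H) \<times> pverts (cartesian_product k H)"
    by (auto simp: cartesian_product_simps)
  moreover have "(y, x) \<in> parcs (cartesian_product k H)" if "(x, y) \<in> parcs (cartesian_product k H)" for x y
  proof -
    from that obtain j where j: "j < k" "(x j, y j) \<in> parcs (H j)" "\<forall>l<k. l \<noteq> j \<longrightarrow> x l = y l"
      by (auto simp: cartesian_product_simps)
    have "(y j, x j) \<in> parcs (H j)"
      using graph_distance.arc_sym[OF factor] j by blast
    moreover have "\<forall>l<k. l \<noteq> j \<longrightarrow> y l = x l" using j(3) by simp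
    ultimately show ?thesis using j(1) that unfolding cartesian_product_simps by blast
  qed
  moreover have "(x, x) \<notin> parcs (cartesian_product k H)" for x
    using graph_distance.arc_neq[OF factor] by (auto simp: cartesian_product_simps)
  ultimately show "pair_graph (cartesian_product k H)"
    unfolding pair_graph_iff sym_def irrefl_def by blast
  show "pverts (cartesian_product k H) \<noteq> {}"
    using graph_distance.nonempty[OF factor] by (auto simp: cartesian_product_simps PiE_eq_empty_iff)
next
  fix x y assume x: "x \<in> pverts (cartesian_product k H)" and y: "y \<in> pverts (cartesian_product k H)"
  have zero: "d j (x j) (y j) = 0 \<longleftrightarrow> x j = y j" if "j < k" for j
    using graph_distance.zero_iff[OF factor[OF that]] product_in_verts x y that by blast
  have ext: "x = y \<longleftrightarrow> (\<forall>j<k. x j = y j)"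
    using x y by (auto simp: cartesian_product_simps intro: PiE_ext)
  show "D x y = 0 \<longleftrightarrow> x = y"
    using zero by (auto simp: ext)
  assume "x \<noteq> y"
  then obtain j where j: "j < k" "x j \<noteq> y j" using ext by blast
  then obtain u where u: "(x j, u) \<in> parcs (H j)" "d j (x j) (y j) = d j u (y j) + 1"
    using graph_distance.descent[OF factor] product_in_verts x y by blast
  have "u \<in> pverts (H j)" using graph_distance.arc_verts(2)[OF factor u(1)] j by blast
  then have "(x, x(j := u)) \<in> parcs (cartesian_product k H)"
    using x u j by (auto simp: cartesian_product_simps PiE_iff extensional_def)
  moreover have "D x y = D (x(j := u)) y + 1"
    using j u by (simp add: sum_remove[of j])
  ultimately show "\<exists>x'. (x, x') \<in> parcs (cartesian_product k H) \<and> D x y = D x' y + 1"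
    by blast
next
  fix x x' y assume arc: "(x, x') \<in> parcs (cartesian_product k H)" and y: "y \<in> pverts (cartesian_product k H)"
  then obtain j where j: "j < k" "(x j, x' j) \<in> parcs (H j)" "\<forall>l<k. l \<noteq> j \<longrightarrow> x l = x' l"
    by (auto simp: cartesian_product_simps)
  have "(\<Sum>l\<in>{..<k} - {j}. d l (x l) (y l)) = (\<Sum>l\<in>{..<k} - {j}. d l (x' l) (y l))"
    using j by (intro sum.cong) auto
  moreover have "d j (x j) (y j) \<le> d j (x' j) (y j) + 1"
    using graph_distance.lipschitz[OF factor] j product_in_verts y by blast
  ultimately show "D x y \<le> D x' y + 1"
    using j(1) by (simp add: sum_remove[of j])
qed

text \<open>The triangle inequality holds in every summand, so equality of the sums forces equality
  in each coordinate. This makes medians and convexity coordinatewise matters.\<close>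

lemma product_between_iff:
  assumes "x \<in> pverts (cartesian_product k H)" "y \<in> pverts (cartesian_product k H)"
    "z \<in> pverts (cartesian_product k H)"
  shows "D x z + D z y = D x y \<longleftrightarrow> (\<forall>j<k. d j (x j) (z j) + d j (z j) (y j) = d j (x j) (y j))"
proof
  assume "D x z + D z y = D x y"
  then have eq: "(\<Sum>j<k. d j (x j) (y j)) = (\<Sum>j<k. d j (x j) (z j) + d j (z j) (y j))"
    by (simp add: sum.distrib)
  have le: "d j (x j) (y j) \<le> d j (x j) (z j) + d j (z j) (y j)" if "j \<in> {..<k}" for j
    using that assms by (intro graph_distance.triangle[OF factor] product_in_verts) auto
  show "\<forall>j<k. d j (x j) (z j) + d j (z j) (y j) = d j (x j) (y j)"
    using sum_mono_inv[OF eq le] by simp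
next
  assume "\<forall>j<k. d j (x j) (z j) + d j (z j) (y j) = d j (x j) (y j)"
  then show "D x z + D z y = D x y"
    by (simp flip: sum.distrib)
qed

lemma median_graph:
  assumes "\<And>j. j < k \<Longrightarrow> median_graph (H j)"
  shows "median_graph (cartesian_product k H)"
proof -
  interpret P: graph_distance "cartesian_product k H" D by (rule graph_distance)
  show ?thesis
    unfolding P.median_graph_iff
  proof (intro ballI)
    fix x y z assume V: "x \<in> pverts (cartesian_product k H)" "y \<in> pverts (cartesian_product k H)"
      "z \<in> pverts (cartesian_product k H)"
    let ?med = "\<lambda>j. graph_distance.median_of (H j) (d j) (x j) (y j) (z j)"
    have iff: "P.median_of x y z m \<longleftrightarrow> m \<in> pverts (cartesian_product k H) \<and> (\<forall>j<k. ?med j (m j))" for m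
      using V product_in_verts[of m] product_between_iff[of x y m] product_between_iff[of y z m]
        product_between_iff[of z x m]
      by (auto simp: P.median_of_def graph_distance.median_of_def[OF factor])
    have ex1: "\<exists>!c. ?med j c" if "j < k" for j
      using assms[OF that] graph_distance.median_graph_iff[OF factor[OF that]]
        product_in_verts[OF _ that] V by blast
    define m where "m = (\<lambda>j\<in>{..<k}. THE c. ?med j c)"
    have med: "?med j (m j)" if "j < k" for j
      using theI'[OF ex1[OF that]] that by (simp add: m_def)
    then have "m \<in> pverts (cartesian_product k H)"
      by (auto simp: cartesian_product_simps m_def graph_distance.median_of_def[OF factor])
    show "\<exists>!m. P.median_of x y z m"
    proof (rule ex1I[of _ m])
      show "P.median_of x y z m" using iff med \<open>m \<in> _\<close> by blast
    next
      fix m' assume m': "P.median_of x y z m'"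
      show "m' = m"
      proof (rule PiE_ext)
        show "m' \<in> (\<Pi>\<^sub>E j\<in>{..<k}. pverts (H j))" "m \<in> (\<Pi>\<^sub>E j\<in>{..<k}. pverts (H j))"
          using m' iff \<open>m \<in> _\<close> by (auto simp: cartesian_product_simps)
        show "m' j = m j" if "j \<in> {..<k}" for j
          using that ex1[of j] med[of j] m' iff by auto
      qed
    qed
  qed
qed

lemma convex_PiE:
  assumes "\<And>j. j < k \<Longrightarrow> geodesically_convex (H j) (S j)"
  shows "geodesically_convex (cartesian_product k H) (\<Pi>\<^sub>E j\<in>{..<k}. S j)"
proof -
  interpret P: graph_distance "cartesian_product k H" D by (rule graph_distance)
  have sub: "(\<Pi>\<^sub>E j\<in>{..<k}. S j) \<subseteq> pverts (cartesian_product k H)"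
    unfolding cartesian_product_simps
    by (intro PiE_mono graph_distance.convex_verts[OF factor assms]) simp_all
  show ?thesis
    unfolding P.convex_iff
  proof (intro conjI ballI impI)
    fix x y z assume xy: "x \<in> (\<Pi>\<^sub>E j\<in>{..<k}. S j)" "y \<in> (\<Pi>\<^sub>E j\<in>{..<k}. S j)"
      and z: "z \<in> pverts (cartesian_product k H)" "D x z + D z y = D x y"
    then have btw: "\<forall>j<k. d j (x j) (z j) + d j (z j) (y j) = d j (x j) (y j)"
      using product_between_iff sub by blast
    have "z j \<in> S j" if "j < k" for j
      by (rule graph_distance.convex_between[OF factor assms, of j "x j" "y j"])
        (use that xy z btw product_in_verts in auto)
    with z show "z \<in> (\<Pi>\<^sub>E j\<in>{..<k}. S j)"
      by (auto simp: cartesian_product_simps)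
  qed (rule sub)
qed

end

section \<open>Tree dimension\<close>

lemma one_vertex_distance: "graph_distance \<lparr>pverts = {c}, parcs = {}\<rparr> (\<lambda>_ _. 0)"
  by (simp add: graph_distance_def pair_graph_iff sym_def irrefl_def)

lemma one_vertex_tree: "undirected_tree \<lparr>pverts = {c}, parcs = {}\<rparr>"
proof -
  interpret graph_distance "\<lparr>pverts = {c}, parcs = {}\<rparr>" "\<lambda>_ _. 0"
    by (rule one_vertex_distance)
  show ?thesis
    unfolding undirected_tree_def using pair_graph connected
    by (auto simp: pre_digraph.cycle_def pre_digraph.awalk_def)
qed

lemma tree_distances_exist:
  assumes "\<And>j. j < k \<Longrightarrow> undirected_tree (T j)"
  shows "\<exists>d. \<forall>j<k. tree_distance (T j) (d j)"
  using tree_distance_exists[OF assms] by metis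

text \<open>The infimum is attained by some \<open>k \<le> i\<close>, and the product of
  \<open>k\<close> trees is padded to exactly \<open>i\<close> factors by one-vertex trees, which
  contribute nothing to distances.\<close>

lemma tree_dimension_le_iff:
  assumes "graph_distance G \<delta>"
  shows "tree_dimension G \<le> enat i \<longleftrightarrow> (\<exists>(T :: nat \<Rightarrow> nat pair_pre_digraph) f.
    (\<forall>j<i. undirected_tree (T j)) \<and> isometric_embedding G (cartesian_product i T) f)"
    (is "_ \<longleftrightarrow> ?E i")
proof
  assume "?E i"
  then show "tree_dimension G \<le> enat i"
    unfolding tree_dimension_def by (intro Inf_lower) blast
next
  assume le: "tree_dimension G \<le> enat i"
  define S where "S = {enat k | k. ?E k}"
  have dim: "tree_dimension G = Inf S"
    by (simp add: tree_dimension_def S_def)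
  \<comment> \<open>The infimum of the empty set is infinite, contrary to the bound
    \<open>enat i\<close>.\<close>
  then have "S \<noteq> {}"
    using le by (intro notI) (simp add: top_enat_def)
  then obtain s where "s \<in> S" by blast
  then have "Inf S \<in> S"
    unfolding Inf_enat_def using \<open>S \<noteq> {}\<close> LeastI[of "\<lambda>x. x \<in> S" s] by simp
  then obtain k where k: "Inf S = enat k" "?E k"
    unfolding S_def by blast
  from k(2) obtain T :: "nat \<Rightarrow> nat pair_pre_digraph" and f where T: "\<forall>j<k. undirected_tree (T j)"
    and f: "isometric_embedding G (cartesian_product k T) f"
    by blast
  have "k \<le> i" using le dim k(1) by simp
  obtain d where d: "\<forall>j<k. tree_distance (T j) (d j)"
    using tree_distances_exist[of k T] T by blast
  define T' where "T' j = (if j < k then T j else \<lparr>pverts = {0}, parcs = {}\<rparr>)" for j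
  define d' where "d' j = (if j < k then d j else (\<lambda>_ _. 0))" for j
  define f' where "f' x = (\<lambda>j\<in>{..<i}. if j < k then f x j else 0)" for x
  interpret P: product_distance k T d
    using d by (simp add: product_distance_def tree_distance_def)
  interpret P': product_distance i T' d'
    using d by (simp add: product_distance_def tree_distance_def T'_def d'_def one_vertex_distance)
  have "P'.D (f' u) (f' v) = P.D (f u) (f v)" for u v
    using \<open>k \<le> i\<close> by (intro sum.mono_neutral_cong_right) (auto simp: d'_def f'_def)
  moreover have "f' \<in> pverts G \<rightarrow> pverts (cartesian_product i T')"
    using f unfolding isometric_embedding_iff[OF assms P.graph_distance]
    by (auto simp: cartesian_product_simps f'_def T'_def Pi_iff PiE_iff)
  ultimately have "isometric_embedding G (cartesian_product i T') f'"
    using f unfolding isometric_embedding_iff[OF assms P.graph_distance]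
      isometric_embedding_iff[OF assms P'.graph_distance] by simp
  moreover have "\<forall>j<i. undirected_tree (T' j)"
    using T by (simp add: T'_def one_vertex_tree)
  ultimately show "?E i" by blast
qed

section \<open>Median decompositions and tree decompositions\<close>

text \<open>The arc is the first one on a shortest path between closest vertices of \<open>A\<close>
  and \<open>B\<close>; all of \<open>A\<close> is nearer to its tail and all of \<open>B\<close>
  nearer to its head.\<close>

lemma (in graph_distance) convex_separation:
  assumes "median_graph G" and A: "geodesically_convex G A" "A \<noteq> {}"
    and B: "geodesically_convex G B" "B \<noteq> {}" and "A \<inter> B = {}"
  shows "\<exists>a a'. (a, a') \<in> parcs G \<and> (\<forall>c\<in>A. \<delta> c a' = \<delta> c a + 1) \<and> (\<forall>c\<in>B. \<delta> c a = \<delta> c a' + 1)"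
proof -
  have sub: "A \<subseteq> pverts G" "B \<subseteq> pverts G"
    using A B convex_verts by auto
  then have "finite (A \<times> B)" "A \<times> B \<noteq> {}"
    using A B finite_verts by (auto intro: finite_subset)
  \<comment> \<open>For a closest pair, \<open>a\<close> and \<open>b\<close> are gates: shortest paths from \<open>A\<close> to \<open>b\<close> pass through \<open>a\<close>
    and those from \<open>a\<close> to \<open>B\<close> through \<open>b\<close>.\<close>
  then obtain p where p: "is_arg_min (\<lambda>(x, y). \<delta> x y) (\<lambda>p. p \<in> A \<times> B) p"
    using ex_is_arg_min_if_finite by blast
  obtain a b where "p = (a, b)" by (cases p)
  then have ab: "a \<in> A" "b \<in> B"
    and min: "\<And>c e. c \<in> A \<Longrightarrow> e \<in> B \<Longrightarrow> \<delta> a b \<le> \<delta> c e"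
    using p by (auto simp: is_arg_min_linorder)
  have V: "a \<in> pverts G" "b \<in> pverts G" using ab sub by auto
  have gate_A: "\<delta> c b = \<delta> c a + \<delta> a b" if c: "c \<in> A" for c
  proof -
    have cV: "c \<in> pverts G" using c sub by auto
    \<comment> \<open>Lying between \<open>c\<close> and \<open>a\<close>, the median is in
      \<open>A\<close>; lying between \<open>a\<close> and \<open>b\<close>, it equals
      \<open>a\<close> by minimality. Hence \<open>a\<close> is between \<open>b\<close> and
      \<open>c\<close>.\<close>
    then obtain m where m: "median_of a b c m"
      using assms(1) V median_graph_iff by blast
    then have mV: "m \<in> pverts G" by (simp add: median_of_def)
    have "m \<in> A"
      using convex_between[OF A(1) c ab(1) mV] m by (simp add: median_of_def)
    then have "\<delta> a b \<le> \<delta> m b" using min ab by blast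
    then have "\<delta> a m = 0" using m by (simp add: median_of_def)
    then have "m = a" using zero_iff V mV by blast
    then show ?thesis
      using m commute[OF V(2) cV] commute[OF V(2,1)] commute[OF V(1) cV] by (simp add: median_of_def)
  qed
  have gate_B: "\<delta> a c = \<delta> a b + \<delta> b c" if c: "c \<in> B" for c
  proof -
    have cV: "c \<in> pverts G" using c sub by auto
    then obtain m where m: "median_of a b c m"
      using assms(1) V median_graph_iff by blast
    then have mV: "m \<in> pverts G" by (simp add: median_of_def)
    have "m \<in> B"
      using convex_between[OF B(1) ab(2) c mV] m by (simp add: median_of_def)
    then have "\<delta> a b \<le> \<delta> a m" using min ab by blast
    then have "\<delta> m b = 0" using m by (simp add: median_of_def)
    then have "m = b" using zero_iff V mV by blast
    then show ?thesis
      using m commute[OF V(2) cV] commute[OF V(2,1)] commute[OF V(1) cV] by (simp add: median_of_def)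
  qed
  have "a \<noteq> b" using ab \<open>A \<inter> B = {}\<close> by blast
  then obtain a' where a': "(a, a') \<in> parcs G" "\<delta> a b = \<delta> a' b + 1"
    using descent V by blast
  have a'V: "a' \<in> pverts G" using a' arc_verts by blast
  have one: "\<delta> a a' = 1" using a' arc_distance by blast
  have "\<delta> c a' = \<delta> c a + 1" if "c \<in> A" for c
  proof -
    have cV: "c \<in> pverts G" using that sub by auto
    show ?thesis
      using gate_A[OF that] triangle[OF cV a'V V(2)] triangle[OF cV V(1) a'V] a' one by simp
  qed
  moreover have "\<delta> c a = \<delta> c a' + 1" if "c \<in> B" for c
  proof -
    have cV: "c \<in> pverts G" using that sub by auto
    show ?thesis
      using gate_B[OF that] triangle[OF a'V V(2) cV] triangle[OF V(1) a'V cV] a' one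
        commute[OF cV V(1)] commute[OF cV a'V] by simp
  qed
  ultimately show ?thesis using a' by blast
qed

text \<open>Each bag is itself one of the intersections, so the width is at most their maximal
  size.\<close>

lemma median_decomposition_from_trees:
  assumes "pair_graph G" and dec: "\<forall>j<i. (T j, Z j) \<in> tree_decompositions G"
  shows "\<exists>M X. (M, X) \<in> median_decompositions G \<and> tree_dimension M \<le> enat i \<and>
    (\<forall>a\<in>pverts M. \<exists>t. (\<forall>j<i. t j \<in> pverts (T j)) \<and> X a = {v \<in> pverts G. \<forall>j<i. v \<in> Z j (t j)})"
proof -
  have tree: "undirected_tree (T j)" if "j < i" for j
    using dec[rule_format, OF that] by (simp add: tree_decompositions_def)
  then obtain d where d: "\<forall>j<i. tree_distance (T j) (d j)"
    using tree_distances_exist by blast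
  then interpret P: product_distance i T d
    by (simp add: product_distance_def tree_distance_def)
  obtain M :: "nat pair_pre_digraph" and f
    where f: "bij_betw f (pverts M) (pverts (cartesian_product i T))"
      and M: "graph_distance M (\<lambda>a b. P.D (f a) (f b))"
    using graph_distance_nat_copy[OF P.graph_distance] by blast
  have f_in: "f a \<in> pverts (cartesian_product i T)" if "a \<in> pverts M" for a
    using f that by (auto simp: bij_betw_def)
  have f_surj: "\<exists>a\<in>pverts M. f a = t" if "t \<in> pverts (cartesian_product i T)" for t
  proof -
    have "t \<in> f ` pverts M" using f that by (simp add: bij_betw_def)
    then show ?thesis by blast
  qed
  have iso: "isometric_embedding M (cartesian_product i T) f"
    using f_in by (simp add: isometric_embedding_iff[OF M P.graph_distance])
  have "median_graph (cartesian_product i T)"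
    by (rule P.median_graph, rule tree_distance.median_graph) (use d in blast)
  then have median: "median_graph M"
    by (rule median_graph_isometric[OF M P.graph_distance iso f])
  define X where "X a = {v \<in> pverts G. \<forall>j<i. v \<in> Z j (f a j)}" for a
  \<comment> \<open>Nodes of \<open>M\<close> correspond to all tuples, so a node can be selected
    one coordinate at a time. This serves both the edges and the non-empty traces.\<close>
  have choose: "\<exists>a\<in>pverts M. \<forall>j<i. Q j (f a j)" if Q: "\<And>j. j < i \<Longrightarrow> \<exists>t\<in>pverts (T j). Q j t" for Q
  proof -
    have "\<forall>j. \<exists>t. j < i \<longrightarrow> t \<in> pverts (T j) \<and> Q j t"
      using Q by blast
    then obtain t where t: "\<forall>j. j < i \<longrightarrow> t j \<in> pverts (T j) \<and> Q j (t j)"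
      by metis
    then have "restrict t {..<i} \<in> pverts (cartesian_product i T)"
      by (auto simp: cartesian_product_simps)
    then obtain a where a: "a \<in> pverts M" "f a = restrict t {..<i}"
      using f_surj by blast
    then show ?thesis using t by (intro bexI[of _ a]) simp_all
  qed
  have "(M, X) \<in> median_decompositions G"
    unfolding median_decompositions_def mem_Collect_eq prod.case
  proof (intro conjI ballI)
    show "median_graph M" by (rule median)
    show "X a \<subseteq> pverts G" for a by (auto simp: X_def)
  next
    fix e assume e: "e \<in> parcs G"
    obtain u v where uv: "e = (u, v)" by (cases e)
    have "\<exists>t\<in>pverts (T j). u \<in> Z j t \<and> v \<in> Z j t" if "j < i" for j
      using dec[rule_format, OF that] e uv by (auto simp: tree_decompositions_def)
    then obtain a where "a \<in> pverts M" "\<forall>j<i. u \<in> Z j (f a j) \<and> v \<in> Z j (f a j)"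
      using choose[of "\<lambda>j t. u \<in> Z j t \<and> v \<in> Z j t"] by blast
    moreover have "u \<in> pverts G" "v \<in> pverts G"
      using assms(1) e uv by (auto simp: pair_graph_iff)
    ultimately show "case e of (u, v) \<Rightarrow> \<exists>a\<in>pverts M. u \<in> X a \<and> v \<in> X a"
      using uv by (auto simp: X_def)
  next
    fix v assume v: "v \<in> pverts G"
    define S where "S j = {t \<in> pverts (T j). v \<in> Z j t}" for j
    have S: "S j \<noteq> {}" "Digraph_Component.connected (with_proj (T j) \<restriction> S j)" if "j < i" for j
      using dec[rule_format, OF that] v by (auto simp: tree_decompositions_def S_def)
    have "\<exists>t\<in>pverts (T j). v \<in> Z j t" if "j < i" for j
      using S(1)[OF that] by (auto simp: S_def)
    then obtain a where "a \<in> pverts M" "\<forall>j<i. v \<in> Z j (f a j)"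
      using choose[of "\<lambda>j t. v \<in> Z j t"] by blast
    then show "{a \<in> pverts M. v \<in> X a} \<noteq> {}"
      using v by (auto simp: X_def)
    have "geodesically_convex (T j) (S j)" if "j < i" for j
      using tree_distance.convex_if_connected[of "T j" "d j" "S j"] S(2)[OF that] d that
      by (auto simp: S_def)
    then have "geodesically_convex M {a \<in> pverts M. f a \<in> (\<Pi>\<^sub>E j\<in>{..<i}. S j)}"
      by (intro convex_vimage[OF M P.graph_distance iso] P.convex_PiE)
    moreover have "v \<in> X a \<longleftrightarrow> f a \<in> (\<Pi>\<^sub>E j\<in>{..<i}. S j)" if "a \<in> pverts M" for a
      using f_in[OF that] v by (auto simp: X_def S_def cartesian_product_simps PiE_iff)
    then have "{a \<in> pverts M. v \<in> X a} = {a \<in> pverts M. f a \<in> (\<Pi>\<^sub>E j\<in>{..<i}. S j)}"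
      by blast
    ultimately show "geodesically_convex M {a \<in> pverts M. v \<in> X a}"
      by simp
  qed
  moreover have "tree_dimension M \<le> enat i"
    unfolding tree_dimension_le_iff[OF M] using tree iso by blast
  moreover have "\<exists>t. (\<forall>j<i. t j \<in> pverts (T j)) \<and> X a = {v \<in> pverts G. \<forall>j<i. v \<in> Z j (t j)}"
    if "a \<in> pverts M" for a
    using P.product_in_verts[OF f_in[OF that]] by (intro exI[of _ "f a"]) (auto simp: X_def)
  ultimately show ?thesis by blast
qed

text \<open>Every intersection is contained in some bag, which bounds its size by the width.\<close>

lemma tree_decompositions_from_median:
  assumes "pair_graph G" "(M, X) \<in> median_decompositions G" "tree_dimension M \<le> enat i"
  shows "\<exists>T Z. (\<forall>j<i. (T j, Z j) \<in> tree_decompositions G) \<and>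
    (\<forall>t. (\<forall>j<i. t j \<in> pverts (T j)) \<longrightarrow>
      (\<exists>a\<in>pverts M. {v \<in> pverts G. \<forall>j<i. v \<in> Z j (t j)} \<subseteq> X a))"
proof -
  have median: "median_graph M"
    and bag: "\<And>a. a \<in> pverts M \<Longrightarrow> X a \<subseteq> pverts G"
    and edge: "\<And>u v. (u, v) \<in> parcs G \<Longrightarrow> \<exists>a\<in>pverts M. u \<in> X a \<and> v \<in> X a"
    and trace: "\<And>v. v \<in> pverts G \<Longrightarrow> {a \<in> pverts M. v \<in> X a} \<noteq> {}"
      "\<And>v. v \<in> pverts G \<Longrightarrow> geodesically_convex M {a \<in> pverts M. v \<in> X a}"
    using assms(2) by (auto simp: median_decompositions_def)
  obtain \<delta> where "graph_distance M \<delta>"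
    using graph_distance_exists[of M] median unfolding median_graph_def by blast
  then interpret M: graph_distance M \<delta> .
  obtain T :: "nat \<Rightarrow> nat pair_pre_digraph" and f where tree: "\<forall>j<i. undirected_tree (T j)"
    and iso: "isometric_embedding M (cartesian_product i T) f"
    using assms(3) tree_dimension_le_iff[OF M.graph_distance_axioms] by blast
  obtain d where d: "\<forall>j<i. tree_distance (T j) (d j)"
    using tree_distances_exist[of i T] tree by blast
  then interpret P: product_distance i T d
    by (simp add: product_distance_def tree_distance_def)
  interpret PD: graph_distance "cartesian_product i T" P.D
    by (rule P.graph_distance)
  have f: "f a \<in> pverts (cartesian_product i T)" if "a \<in> pverts M" for a
    using iso that by (auto simp: isometric_embedding_def)
  have dist: "P.D (f a) (f b) = \<delta> a b" if "a \<in> pverts M" "b \<in> pverts M" for a b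
    using iso that by (simp add: isometric_embedding_iff[OF M.graph_distance_axioms P.graph_distance])
  \<comment> \<open>The embedding sends an arc to two tuples at distance one, and these are adjacent
    in the product.\<close>
  have arc_step: "\<exists>j<i. (f a j, f b j) \<in> parcs (T j) \<and> (\<forall>l<i. l \<noteq> j \<longrightarrow> f a l = f b l)"
    if "(a, b) \<in> parcs M" for a b
  proof -
    have V: "a \<in> pverts M" "b \<in> pverts M" using that M.arc_verts by auto
    then have "P.D (f a) (f b) = 1" using dist M.arc_distance[OF that] by simp
    then have "(f a, f b) \<in> parcs (cartesian_product i T)"
      using PD.distance_one_arc V f by blast
    then show ?thesis by (simp add: cartesian_product_simps)
  qed
  define Z where "Z j t = {v \<in> pverts G. \<exists>a\<in>pverts M. f a j = t \<and> v \<in> X a}" for j t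
  have "(T j, Z j) \<in> tree_decompositions G" if j: "j < i" for j
    unfolding tree_decompositions_def mem_Collect_eq prod.case
  proof (intro conjI ballI)
    show "undirected_tree (T j)" using tree j by blast
    show "Z j t \<subseteq> pverts G" for t by (auto simp: Z_def)
  next
    fix e assume e: "e \<in> parcs G"
    obtain u v where uv: "e = (u, v)" by (cases e)
    obtain a where a: "a \<in> pverts M" "u \<in> X a" "v \<in> X a"
      using edge e uv by blast
    then have "u \<in> Z j (f a j)" "v \<in> Z j (f a j)"
      using bag[OF a(1)] by (auto simp: Z_def)
    then show "case e of (u, v) \<Rightarrow> \<exists>t\<in>pverts (T j). u \<in> Z j t \<and> v \<in> Z j t"
      using uv P.product_in_verts[OF f[OF a(1)] j] by auto
  next
    fix v assume v: "v \<in> pverts G"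
    define C where "C = {a \<in> pverts M. v \<in> X a}"
    have C: "C \<noteq> {}" "geodesically_convex M C" using trace[OF v] by (simp_all add: C_def)
    have CV: "C \<subseteq> pverts M" by (auto simp: C_def)
    have eq: "{t \<in> pverts (T j). v \<in> Z j t} = (\<lambda>a. f a j) ` C"
      using v P.product_in_verts[OF f _] j by (auto simp: Z_def C_def)
    show "{t \<in> pverts (T j). v \<in> Z j t} \<noteq> {}"
      unfolding eq using C by simp
    \<comment> \<open>A shortest path inside the convex set \<open>C\<close> projects to a walk in
      \<open>T j\<close> that may pause at a vertex; hence the projected trace is connected.\<close>
    have walk: "a \<in> C \<longrightarrow> (f a j, f b j) \<in> rtrancl_on ((\<lambda>a. f a j) ` C) (parcs (T j))"
      if "a \<in> pverts M" and b: "b \<in> C" for a b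
      using that(1) subsetD[OF CV b]
    proof (induction rule: M.descent_induct)
      case base
      then show ?case by auto
    next
      case (step a a')
      show ?case
      proof
        assume a: "a \<in> C"
        have a'V: "a' \<in> pverts M" using step M.arc_verts by blast
        have "a' \<in> C"
          using M.convex_between[OF C(2) a b a'V] step(2) M.arc_distance[OF step(1)] by simp
        then have walk': "(f a' j, f b j) \<in> rtrancl_on ((\<lambda>a. f a j) ` C) (parcs (T j))"
          using step by blast
        have "f a j = f a' j \<or> (f a j, f a' j) \<in> parcs (T j)"
          using arc_step[OF step(1)] j by metis
        then show "(f a j, f b j) \<in> rtrancl_on ((\<lambda>a. f a j) ` C) (parcs (T j))"
          using walk' a by (auto intro: converse_rtrancl_on_into_rtrancl_on)
      qed
    qed
    have "pair_graph (T j)" using tree j by (simp add: undirected_tree_def)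
    then show "Digraph_Component.connected (with_proj (T j) \<restriction> {t \<in> pverts (T j). v \<in> Z j t})"
      unfolding eq using C walk CV by (auto simp: connected_induce_subgraph_iff)
  qed
  moreover have "\<exists>a\<in>pverts M. {v \<in> pverts G. \<forall>j<i. v \<in> Z j (t j)} \<subseteq> X a" for t
  proof -
    define I where "I = {v \<in> pverts G. \<forall>j<i. v \<in> Z j (t j)}"
    define C where "C v = {a \<in> pverts M. v \<in> X a}" for v
    have C: "geodesically_convex M (C v)" "C v \<noteq> {}" if "v \<in> I" for v
      using trace that by (auto simp: C_def I_def)
    have "C u \<inter> C v \<noteq> {}" if uv: "u \<in> I" "v \<in> I" for u v
    proof
      assume "C u \<inter> C v = {}"
      then obtain a a' where arc: "(a, a') \<in> parcs M"
        and u: "\<forall>c\<in>C u. \<delta> c a' = \<delta> c a + 1" and v: "\<forall>c\<in>C v. \<delta> c a = \<delta> c a' + 1"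
        using M.convex_separation[OF median] C uv by meson
      obtain j where j: "j < i" "\<forall>l<i. l \<noteq> j \<longrightarrow> f a l = f a' l"
        using arc_step[OF arc] by blast
      have V: "a \<in> pverts M" "a' \<in> pverts M" using arc M.arc_verts by auto
      \<comment> \<open>Since \<open>a\<close> and \<open>a'\<close> agree outside coordinate
        \<open>j\<close>, the difference of their distances to \<open>c\<close> depends on
        \<open>c\<close> only through \<open>f c j\<close>.\<close>
      have coord: "d j (f c j) (f a j) + \<delta> c a' = d j (f c j) (f a' j) + \<delta> c a" if "c \<in> pverts M" for c
      proof -
        have "(\<Sum>l\<in>{..<i} - {j}. d l (f c l) (f a l)) = (\<Sum>l\<in>{..<i} - {j}. d l (f c l) (f a' l))"
          using j by (intro sum.cong) auto
        then show ?thesis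
          using dist[OF that V(1)] dist[OF that V(2)] j(1) by (simp add: P.sum_remove[of j])
      qed
      obtain c where c: "c \<in> C u" "f c j = t j"
        using uv(1) j(1) by (auto simp: I_def Z_def C_def)
      obtain c' where c': "c' \<in> C v" "f c' j = t j"
        using uv(2) j(1) by (auto simp: I_def Z_def C_def)
      have "c \<in> pverts M" "c' \<in> pverts M" using c c' by (auto simp: C_def)
      \<comment> \<open>Both \<open>c\<close> and \<open>c'\<close> have \<open>j\<close>-th
        coordinate \<open>t j\<close>, so this difference is the same for them, yet the separation
        makes it \<open>1\<close> for one and \<open>-1\<close> for the other.\<close>
      then show False
        using coord[of c] coord[of c'] u v c c' by simp
    qed
    moreover have "finite I"
      using assms(1) by (simp add: I_def pair_graph_iff)
    ultimately obtain a where "a \<in> pverts M" "\<forall>v\<in>I. a \<in> C v"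
      using M.Helly[OF median, of I C] C by blast
    then show ?thesis by (auto simp: I_def C_def)
  qed
  ultimately show ?thesis by blast
qed

section \<open>From the two constructions to the equality of the minima\<close>

lemma Least_nat_eqI:
  fixes P Q :: "nat \<Rightarrow> bool"
  assumes PQ: "\<And>n. P n \<Longrightarrow> \<exists>m\<le>n. Q m" and QP: "\<And>n. Q n \<Longrightarrow> \<exists>m\<le>n. P m"
  shows "(LEAST n. P n) = (LEAST n. Q n)"
proof (cases "\<exists>n. P n")
  case True
  then have "P (LEAST n. P n)" by (rule LeastI_ex)
  then obtain m where m: "m \<le> (LEAST n. P n)" "Q m" using PQ by blast
  then have "Q (LEAST n. Q n)" by (intro LeastI)
  then obtain k where k: "k \<le> (LEAST n. Q n)" "P k" using QP by blast
  have "(LEAST n. Q n) \<le> m" "(LEAST n. P n) \<le> k"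
    using m k by (auto intro: Least_le)
  then show ?thesis using m k by simp
next
  case False
  then have "P = (\<lambda>_. False)" "Q = (\<lambda>_. False)" using QP by blast+
  then show ?thesis by simp
qed

text \<open>Passes from the indices \<open>{1..i}\<close> to the indices below \<open>i\<close> used
  for products. As \<open>i \<ge> 1\<close>, some bag keeps the intersection within
  \<open>pverts G\<close>; an empty intersection would be the whole type.\<close>

lemma INT_bags_eq:
  assumes "i \<ge> 1" and "\<forall>j\<in>{1..i}. D j \<in> tree_decompositions G"
    and "\<forall>j\<in>{1..i}. t j \<in> pverts (fst (D j))"
  shows "(\<Inter>j\<in>{1..i}. snd (D j) (t j)) = {v \<in> pverts G. \<forall>j<i. v \<in> snd (D (Suc j)) (t (Suc j))}"
proof -
  have "{1..i} = Suc ` {..<i}"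
    by (auto simp: image_iff Suc_le_eq gr0_conv_Suc)
  then have eq: "(\<Inter>j\<in>{1..i}. snd (D j) (t j)) = {v. \<forall>j<i. v \<in> snd (D (Suc j)) (t (Suc j))}"
    by auto
  have "snd (D 1) (t 1) \<subseteq> pverts G"
    using assms by (force simp: tree_decompositions_def)
  then have "v \<in> pverts G" if "\<forall>j<i. v \<in> snd (D (Suc j)) (t (Suc j))" for v
    using that assms(1) by auto
  then show ?thesis unfolding eq by blast
qed

theorem theorem5p7:
  fixes G :: "'a pair_pre_digraph" and i :: nat
  assumes "pair_graph G" and "i \<ge> 1"
  shows "mw i G =
    (LEAST m. \<exists>D :: nat \<Rightarrow> nat pair_pre_digraph \<times> (nat \<Rightarrow> 'a set).
       (\<forall>j\<in>{1..i}. D j \<in> tree_decompositions G) \<and>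
       m = Max {card (\<Inter>j\<in>{1..i}. snd (D j) (t j)) | t. \<forall>j\<in>{1..i}. t j \<in> pverts (fst (D j))})"
  unfolding mw_def
proof (rule Least_nat_eqI)
  fix w
  assume "\<exists>D\<in>median_decompositions G. tree_dimension (fst D) \<le> enat i \<and> width D = w"
  then obtain M X where MX: "(M, X) \<in> median_decompositions G" "tree_dimension M \<le> enat i"
    and w: "w = width (M, X)"
    by auto
  obtain T Z where dec: "\<forall>j<i. (T j, Z j) \<in> tree_decompositions G"
    and bags: "\<And>t. \<forall>j<i. t j \<in> pverts (T j) \<Longrightarrow> \<exists>a\<in>pverts M. {v \<in> pverts G. \<forall>j<i. v \<in> Z j (t j)} \<subseteq> X a"
    using tree_decompositions_from_median[OF assms(1) MX] by blast
  define D where "D j = (T (j - 1), Z (j - 1))" for j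
  have D: "\<forall>j\<in>{1..i}. D j \<in> tree_decompositions G"
    using dec by (auto simp: D_def)
  have finite_M: "finite (pverts M)" and X: "X a \<subseteq> pverts G" if "a \<in> pverts M" for a
    using MX(1) that by (auto simp: median_decompositions_def median_graph_def pair_graph_iff)
  have "card (\<Inter>j\<in>{1..i}. snd (D j) (t j)) \<le> w" if t: "\<forall>j\<in>{1..i}. t j \<in> pverts (fst (D j))" for t
  proof -
    have "\<forall>j<i. t (Suc j) \<in> pverts (T j)"
      using t by (auto simp: D_def dest!: bspec[of _ _ "Suc _"])
    then obtain a where a: "a \<in> pverts M" "{v \<in> pverts G. \<forall>j<i. v \<in> Z j (t (Suc j))} \<subseteq> X a"
      using bags[of "\<lambda>j. t (Suc j)"] by blast
    have "(\<Inter>j\<in>{1..i}. snd (D j) (t j)) \<subseteq> X a"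
      using a INT_bags_eq[OF assms(2) D t] by (simp add: D_def)
    then have "card (\<Inter>j\<in>{1..i}. snd (D j) (t j)) \<le> card (X a)"
      using X[OF a(1)] assms(1) by (auto simp: pair_graph_iff intro!: card_mono intro: finite_subset)
    also have "\<dots> \<le> w"
      unfolding w width_def using finite_M[OF a(1)] a(1) by (auto intro!: Max_ge)
    finally show ?thesis .
  qed
  \<comment> \<open>Values of \<open>t\<close> outside \<open>{1..i}\<close> are free, so infinitely
    many \<open>t\<close> qualify; the finiteness that \<open>Max\<close> requires comes from this
    bound on the cardinalities.\<close>
  then have le: "\<forall>n\<in>{card (\<Inter>j\<in>{1..i}. snd (D j) (t j)) | t. \<forall>j\<in>{1..i}. t j \<in> pverts (fst (D j))}. n \<le> w"
    by blast
  moreover have "\<exists>t. \<forall>j\<in>{1..i}. t j \<in> pverts (fst (D j))"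
  proof -
    have "\<forall>j\<in>{1..i}. \<exists>t. t \<in> pverts (fst (D j))"
      using D by (fastforce simp: tree_decompositions_def undirected_tree_def connected_iff)
    then show ?thesis by metis
  qed
  moreover have "finite {card (\<Inter>j\<in>{1..i}. snd (D j) (t j)) | t. \<forall>j\<in>{1..i}. t j \<in> pverts (fst (D j))}"
    using le by (auto intro: finite_subset[of _ "{..w}"])
  ultimately have "Max {card (\<Inter>j\<in>{1..i}. snd (D j) (t j)) | t. \<forall>j\<in>{1..i}. t j \<in> pverts (fst (D j))} \<le> w"
    by (subst Max_le_iff) auto
  then show "\<exists>m\<le>w. \<exists>D. (\<forall>j\<in>{1..i}. D j \<in> tree_decompositions G) \<and>
     m = Max {card (\<Inter>j\<in>{1..i}. snd (D j) (t j)) | t. \<forall>j\<in>{1..i}. t j \<in> pverts (fst (D j))}"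
    using D by blast
next
  fix m
  assume "\<exists>D :: nat \<Rightarrow> nat pair_pre_digraph \<times> (nat \<Rightarrow> 'a set). (\<forall>j\<in>{1..i}. D j \<in> tree_decompositions G) \<and>
     m = Max {card (\<Inter>j\<in>{1..i}. snd (D j) (t j)) | t. \<forall>j\<in>{1..i}. t j \<in> pverts (fst (D j))}"
  then obtain D :: "nat \<Rightarrow> nat pair_pre_digraph \<times> (nat \<Rightarrow> 'a set)"
    where D: "\<forall>j\<in>{1..i}. D j \<in> tree_decompositions G"
      and m: "m = Max {card (\<Inter>j\<in>{1..i}. snd (D j) (t j)) | t. \<forall>j\<in>{1..i}. t j \<in> pverts (fst (D j))}"
    by blast
  have "\<forall>j<i. (fst (D (Suc j)), snd (D (Suc j))) \<in> tree_decompositions G"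
    using D by simp
  from median_decomposition_from_trees[OF assms(1) this] obtain M X
    where MX: "(M, X) \<in> median_decompositions G" "tree_dimension M \<le> enat i"
      and bags: "\<forall>a\<in>pverts M. \<exists>t. (\<forall>j<i. t j \<in> pverts (fst (D (Suc j)))) \<and>
        X a = {v \<in> pverts G. \<forall>j<i. v \<in> snd (D (Suc j)) (t j)}"
    by blast
  have "card (\<Inter>j\<in>{1..i}. snd (D j) (t j)) \<le> card (pverts G)"
    if t: "\<forall>j\<in>{1..i}. t j \<in> pverts (fst (D j))" for t
    unfolding INT_bags_eq[OF assms(2) D t] using assms(1) by (intro card_mono) (auto simp: pair_graph_iff)
  then have fin: "finite {card (\<Inter>j\<in>{1..i}. snd (D j) (t j)) | t. \<forall>j\<in>{1..i}. t j \<in> pverts (fst (D j))}"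
    by (auto intro: finite_subset[of _ "{..card (pverts G)}"])
  have "card (X a) \<le> m" if a: "a \<in> pverts M" for a
  proof -
    obtain t where t: "\<forall>j<i. t j \<in> pverts (fst (D (Suc j)))"
      and Xa: "X a = {v \<in> pverts G. \<forall>j<i. v \<in> snd (D (Suc j)) (t j)}"
      using bags a by blast
    \<comment> \<open>The node tuple is shifted back to indices starting at \<open>1\<close>, which
      exhibits the bag as a member of the set whose maximum is \<open>m\<close>.\<close>
    have t': "\<forall>j\<in>{1..i}. t (j - 1) \<in> pverts (fst (D j))"
    proof
      fix j assume "j \<in> {1..i}"
      then obtain l where "j = Suc l" "l < i" by (cases j) auto
      then show "t (j - 1) \<in> pverts (fst (D j))" using t by simp
    qed
    have "X a = (\<Inter>j\<in>{1..i}. snd (D j) (t (j - 1)))"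
      using INT_bags_eq[OF assms(2) D t'] by (simp add: Xa)
    then show ?thesis
      unfolding m using t' by (intro Max_ge[OF fin]) (auto intro!: exI[of _ "\<lambda>j. t (j - 1)"])
  qed
  moreover have "finite (pverts M)" "pverts M \<noteq> {}"
    using MX(1) by (auto simp: median_decompositions_def median_graph_def pair_graph_iff connected_iff)
  ultimately have "width (M, X) \<le> m"
    unfolding width_def by (subst Max_le_iff) auto
  then show "\<exists>w\<le>m. \<exists>D\<in>median_decompositions G. tree_dimension (fst D) \<le> enat i \<and> width D = w"
    using MX by (intro exI[of _ "width (M, X)"] conjI bexI[of _ "(M, X)"]) simp_all
qed

end
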